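(* Suppose $C$ is a unit circle embedded in the Euclidean space $\mathbb{R}^3$. Let $\rho$ be the distance to the circle $C$. Then for any positive integer $k$, there is a $\mathbb{Z}_2$ harmonic function $f$ on $\mathbb{R}^3\setminus C$ with monodromy $-1$ around $C$ such that $|f|=O(\rho^k)$ as $\rho\to 0$.
   Context: $\mathcal{L}$ is the unique real line bundle on $\mathbb{R}^3\setminus C$ with monodromy $-1$ around $C$. A $\mathbb{Z}_2$ function is a section of $\mathcal{L}$; in a local trivialization it is an ordinary real function, well defined up to sign. A $\mathbb{Z}_2$ harmonic function is a $\mathbb{Z}_2$ function $f$ with $\Delta f=0$ in every local trivialization and such that $|\nabla f|$ has finite $L^2$ norm on every bounded open subset of $\mathbb{R}^3\setminus C$ (including neighborhoods of $C$ with $C$ removed). *)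

theory Defs
  imports "HOL-Analysis.Analysis" "HOL-Library.Landau_Symbols"
begin

subsection \<open>Harmonic functions of three variables\<close>

definition partial :: "real ^ 3 \<Rightarrow> (real ^ 3 \<Rightarrow> real) \<Rightarrow> real ^ 3 \<Rightarrow> real" where
  "partial b g x = frechet_derivative g (at x) b"

definition gradient :: "(real ^ 3 \<Rightarrow> real) \<Rightarrow> real ^ 3 \<Rightarrow> real ^ 3" where
  "gradient g x = (\<Sum>b\<in>Basis. partial b g x *\<^sub>R b)"

definition laplacian :: "(real ^ 3 \<Rightarrow> real) \<Rightarrow> real ^ 3 \<Rightarrow> real" where
  "laplacian g x = (\<Sum>b\<in>Basis. partial b (partial b g) x)"

definition C2_on :: "(real ^ 3) set \<Rightarrow> (real ^ 3 \<Rightarrow> real) \<Rightarrow> bool" where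
  "C2_on U g \<longleftrightarrow> g differentiable_on U \<and>
     (\<forall>b\<in>Basis. partial b g differentiable_on U) \<and>
     (\<forall>b\<in>Basis. \<forall>c\<in>Basis. continuous_on U (partial b (partial c g)))"

definition harmonic_on :: "(real ^ 3) set \<Rightarrow> (real ^ 3 \<Rightarrow> real) \<Rightarrow> bool" where
  "harmonic_on U g \<longleftrightarrow> C2_on U g \<and> (\<forall>x\<in>U. laplacian g x = 0)"


subsection \<open>Real line bundles with structure group \<open>{1, -1}\<close>\<close>

text \<open>
  The structure group of a real line bundle reduces to \<open>{1, -1}\<close>. The bundle is given by its fibres
  and an atlas of local trivializations: in \<open>(U, \<phi>)\<close>, the map \<open>\<phi> x\<close> identifies the real
  line with the fibre over the point \<open>x\<close> of the open set \<open>U\<close>. Two trivializations differ by a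
  locally constant sign. The topology and the linear structure are those induced by the atlas.
\<close>

record 'e line_bundle =
  fibre :: "real ^ 3 \<Rightarrow> 'e set"
  trivs :: "((real ^ 3) set \<times> (real ^ 3 \<Rightarrow> real \<Rightarrow> 'e)) set"

definition real_line_bundle :: "(real ^ 3) set \<Rightarrow> 'e line_bundle \<Rightarrow> bool" where
  "real_line_bundle S L \<longleftrightarrow>
     (\<forall>(U, \<phi>)\<in>trivs L. open U \<and> U \<subseteq> S \<and> (\<forall>x\<in>U. bij_betw (\<phi> x) UNIV (fibre L x))) \<and>
     S \<subseteq> (\<Union>(U, \<phi>)\<in>trivs L. U) \<and>
     (\<forall>(U, \<phi>)\<in>trivs L. \<forall>(V, \<psi>)\<in>trivs L. \<forall>x\<in>U \<inter> V.
        \<exists>s\<in>{1, -1}. \<forall>\<^sub>F y in nhds x. \<forall>t. \<psi> y t = \<phi> y (s * t))"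

definition is_section :: "(real ^ 3) set \<Rightarrow> 'e line_bundle \<Rightarrow> (real ^ 3 \<Rightarrow> 'e) \<Rightarrow> bool" where
  "is_section S L f \<longleftrightarrow> (\<forall>x\<in>S. f x \<in> fibre L x)"

definition local_rep :: "(real ^ 3 \<Rightarrow> real \<Rightarrow> 'e) \<Rightarrow> (real ^ 3 \<Rightarrow> 'e) \<Rightarrow> real ^ 3 \<Rightarrow> real" where
  "local_rep \<phi> f x = inv (\<phi> x) (f x)"

text \<open>
  \<open>|f|\<close> and \<open>|\<nabla>f|\<close>, computed in any trivialization around the point; a change of
  trivialization only changes the sign of the local representative.
\<close>

definition abs_sec :: "'e line_bundle \<Rightarrow> (real ^ 3 \<Rightarrow> 'e) \<Rightarrow> real ^ 3 \<Rightarrow> real" where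
  "abs_sec L f x = (THE r. \<exists>(U, \<phi>)\<in>trivs L. x \<in> U \<and> r = \<bar>local_rep \<phi> f x\<bar>)"

definition norm_grad_sec :: "'e line_bundle \<Rightarrow> (real ^ 3 \<Rightarrow> 'e) \<Rightarrow> real ^ 3 \<Rightarrow> real" where
  "norm_grad_sec L f x =
     (THE r. \<exists>(U, \<phi>)\<in>trivs L. x \<in> U \<and> r = norm (gradient (local_rep \<phi> f) x))"

text \<open>
  A flat lift \<open>u\<close> of a path \<open>\<gamma>\<close> has locally constant coordinate in every trivialization. The
  monodromy along a loop is the factor \<open>m\<close> with \<open>u 1 = m u 0\<close> for the flat lifts \<open>u\<close>.
\<close>

definition flat_lift :: "'e line_bundle \<Rightarrow> (real \<Rightarrow> real ^ 3) \<Rightarrow> (real \<Rightarrow> 'e) \<Rightarrow> bool" where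
  "flat_lift L \<gamma> u \<longleftrightarrow>
     (\<forall>t\<in>{0..1}. u t \<in> fibre L (\<gamma> t)) \<and>
     (\<forall>(U, \<phi>)\<in>trivs L. \<forall>t\<in>{0..1}. \<gamma> t \<in> U \<longrightarrow>
        (\<exists>c. \<exists>\<epsilon>>0. \<forall>\<tau>\<in>{0..1}. \<bar>\<tau> - t\<bar> < \<epsilon> \<longrightarrow> u \<tau> = \<phi> (\<gamma> \<tau>) c))"

definition monodromy :: "'e line_bundle \<Rightarrow> (real \<Rightarrow> real ^ 3) \<Rightarrow> real \<Rightarrow> bool" where
  "monodromy L \<gamma> m \<longleftrightarrow>
     (\<forall>u. flat_lift L \<gamma> u \<longrightarrow>
        (\<forall>(U, \<phi>)\<in>trivs L. \<gamma> 0 \<in> U \<longrightarrow> inv (\<phi> (\<gamma> 0)) (u 1) = m * inv (\<phi> (\<gamma> 0)) (u 0)))"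


subsection \<open>The unit circle and its meridians\<close>

definition unit_circle :: "real ^ 3 \<Rightarrow> real ^ 3 \<Rightarrow> (real ^ 3) set" where
  "unit_circle a n = {x. dist a x = 1 \<and> (x - a) \<bullet> n = 0}"

text \<open>
  The circle of radius \<open>\<epsilon> < 1\<close> around a point \<open>c\<close> of the unit circle, in the plane through
  \<open>c\<close> orthogonal to the unit circle (that plane is spanned by \<open>c - a\<close> and \<open>n\<close>).
\<close>

definition meridian :: "real ^ 3 \<Rightarrow> real ^ 3 \<Rightarrow> real ^ 3 \<Rightarrow> real \<Rightarrow> real \<Rightarrow> real ^ 3" where
  "meridian a n c \<epsilon> t =
     c + (\<epsilon> * cos (2 * pi * t)) *\<^sub>R (c - a) + (\<epsilon> * sin (2 * pi * t)) *\<^sub>R n"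

definition twisted_around_circle :: "real ^ 3 \<Rightarrow> real ^ 3 \<Rightarrow> 'e line_bundle \<Rightarrow> bool" where
  "twisted_around_circle a n L \<longleftrightarrow>
     (\<forall>c\<in>unit_circle a n. \<forall>\<epsilon>\<in>{0<..<1}. monodromy L (meridian a n c \<epsilon>) (-1))"


subsection \<open>\<open>\<int>\<^sub>2\<close> harmonic functions\<close>

definition Z2_harmonic :: "(real ^ 3) set \<Rightarrow> 'e line_bundle \<Rightarrow> (real ^ 3 \<Rightarrow> 'e) \<Rightarrow> bool" where
  "Z2_harmonic S L f \<longleftrightarrow>
     is_section S L f \<and>
     (\<forall>(U, \<phi>)\<in>trivs L. harmonic_on U (local_rep \<phi> f)) \<and>
     (\<forall>B. open B \<and> bounded B \<and> B \<subseteq> S \<longrightarrow>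
        set_integrable lborel B (\<lambda>x. (norm_grad_sec L f x)\<^sup>2))"

end

theory Submission
  imports Defs
begin

text \<open>
  Put \<open>q = x - a\<close>. The circle is the zero set of the squared complex distance
  \<open>q \<bullet> q - 1 + 2 i (q \<bullet> n)\<close>, and a local square root \<open>w = s + i t\<close> of it gives the oblate spheroidal
  coordinates \<open>s, t\<close>, which change sign along a meridian. A function \<open>F\<close> of \<open>w\<close> is harmonic as soon as
  \<open>(1 + s\<^sup>2) F\<^sub>s\<^sub>s + 2 s F\<^sub>s + (1 - t\<^sup>2) F\<^sub>t\<^sub>t - 2 t F\<^sub>t = 0\<close>, and an odd \<open>F\<close> defines a section of the
  twisted bundle. Separation of variables provides infinitely many independent odd solutions
  \<open>A\<^sub>l(t) T\<^sub>l(s)\<close>, with \<open>A\<^sub>l\<close> the Legendre polynomial of degree \<open>2 l\<close> and \<open>T\<^sub>l\<close> an odd solution of the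
  Legendre equation on the imaginary axis. Only finitely many linear conditions express that a linear
  combination is \<open>O(\<bar>w\<bar>\<^sup>2\<^sup>k)\<close>, and \<open>\<bar>w\<bar>\<^sup>2\<close> is near the circle comparable to the distance from it.

  That the values \<open>F w\<close> glue to a section of the given bundle is seen from a flat section over the
  star-shaped complement of the exterior of the disc: by the monodromy it changes sign across that
  exterior, just as the root \<open>w\<close> does.
\<close>

section \<open>Solutions in spheroidal coordinates\<close>

text \<open>Vanishing of \<open>F\<close> at the circle does not by itself control the energy. A
  branch satisfies 2 w dw = dz, with z the squared complex distance, so dw grows like 1/|w|. For
  this reason both first derivatives of \<open>F\<close> are also made to vanish at w = 0: the
  factor |w| gained cancels 1/|w|, and the gradient is bounded on bounded sets. The axis of the
  circle is t = 1 or t = -1, where the angular equation is singular; this is why the factor in t is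
  a polynomial. The radial equation has no singularity for real s, and no decay at infinity is
  asked, so every odd solution T may be used. Such a T is never a polynomial: a polynomial solution
  of the radial equation has even degree. Counting gives a nonzero coefficient vector c, not yet a
  nonzero function. Since all T have slope 1 at s = 0, the s-derivative of the combination there is
  the sum of the c(l) A(l), which is nonzero because the degrees differ.\<close>

fun legendre_coeff :: "real \<Rightarrow> nat \<Rightarrow> nat \<Rightarrow> real" where
  "legendre_coeff e l 0 = 1"
| "legendre_coeff e l (Suc 0) = 0"
| "legendre_coeff e l (Suc (Suc m)) =
     e * (2 * real l * (2 * real l + 1) - real m * (real m + 1))
       / ((real m + 1) * (real m + 2)) * legendre_coeff e l m"

lemma legendre_coeff_odd: "odd m \<Longrightarrow> legendre_coeff e l m = 0"
  by (induction e l m rule: legendre_coeff.induct) auto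

text \<open>At \<open>m = 2 * l\<close> the numerator of the recurrence vanishes and ends the
  series; the other index that the induction hypothesis misses is odd.\<close>

lemma legendre_coeff_eq_0: "m > 2 * l \<Longrightarrow> legendre_coeff e l m = 0"
proof (induction e l m rule: legendre_coeff.induct)
  case (3 e l m)
  show ?case
  proof (cases "m > 2 * l")
    case True then show ?thesis using 3 by simp
  next
    case False
    then have "m = 2 * l \<or> odd m" using 3(2) by presburger
    then show ?thesis by (auto simp: legendre_coeff_odd)
  qed
qed auto

lemma legendre_coeff_nonneg: "legendre_coeff 1 l m \<ge> 0"
proof (induction "1::real" l m rule: legendre_coeff.induct)
  case (3 l m)
  show ?case
  proof (cases "m > 2 * l")
    case True then show ?thesis by (simp add: legendre_coeff_eq_0)
  next
    case False
    then have "real m \<le> 2 * real l" by linarith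
    then have "real m * (real m + 1) \<le> 2 * real l * (2 * real l + 1)"
      by (intro mult_mono) auto
    then show ?thesis using 3 by (simp add: divide_nonneg_nonneg)
  qed
qed auto

text \<open>No numerator vanishes before index \<open>2 * l\<close>, so the polynomial has degree
  exactly \<open>2 * l\<close>.\<close>

lemma legendre_coeff_lead:
  assumes "e \<noteq> 0" "j \<le> l" shows "legendre_coeff e l (2 * j) \<noteq> 0"
  using assms(2)
proof (induction j)
  case (Suc j)
  have "real (2 * j) < 2 * real l" using Suc by simp
  then have "real (2 * j) * (real (2 * j) + 1) < 2 * real l * (2 * real l + 1)"
    by (intro mult_strict_mono) auto
  moreover have "2 * Suc j = Suc (Suc (2 * j))" by simp
  ultimately show ?case using Suc assms(1)
    by (simp del: of_nat_mult mult_Suc_right)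
qed auto

text \<open>For \<open>e = -1\<close> this is the Legendre polynomial of degree \<open>2 * l\<close>
  divided by its value at 0; for \<open>e = 1\<close> it is that same function evaluated at i x. One
  recurrence thus serves the angular and the radial equation.\<close>

definition legendre_poly :: "real \<Rightarrow> nat \<Rightarrow> real poly" where
  "legendre_poly e l = (\<Sum>m\<le>2 * l. monom (legendre_coeff e l m) m)"

lemma coeff_legendre_poly [simp]: "coeff (legendre_poly e l) m = legendre_coeff e l m"
  by (cases "m \<le> 2 * l") (simp_all add: legendre_poly_def coeff_sum legendre_coeff_eq_0)

lemma legendre_coeff_recurrence:
  "(real m + 1) * (real m + 2) * legendre_coeff e l (Suc (Suc m))
     = e * (2 * real l * (2 * real l + 1) - real m * (real m + 1)) * legendre_coeff e l m"
  by (simp add: divide_simps)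

lemma legendre_poly_ode:
  "[:1, 0, e:] * pderiv (pderiv (legendre_poly e l)) + [:0, 2 * e:] * pderiv (legendre_poly e l)
     = smult (e * (2 * real l * (2 * real l + 1))) (legendre_poly e l)"
proof (rule poly_eqI)
  fix m
  note rec = legendre_coeff_recurrence[of m e l]
  consider "m = 0" | "m = Suc 0" | j where "m = Suc (Suc j)"
    by (metis not0_implies_Suc)
  then show "coeff ([:1, 0, e:] * pderiv (pderiv (legendre_poly e l))
        + [:0, 2 * e:] * pderiv (legendre_poly e l)) m
     = coeff (smult (e * (2 * real l * (2 * real l + 1))) (legendre_poly e l)) m"
  proof cases
    case 3
    then show ?thesis
      using rec by (simp add: coeff_pderiv algebra_simps del: legendre_coeff.simps)
  qed (auto simp: coeff_pderiv)
qed

lemma legendre_ode: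
  "(1 + e * x\<^sup>2) * poly (pderiv (pderiv (legendre_poly e l))) x + 2 * e * x * poly (pderiv (legendre_poly e l)) x
     = e * (2 * real l * (2 * real l + 1)) * poly (legendre_poly e l) x"
  using arg_cong[OF legendre_poly_ode[of e l], of "\<lambda>p. poly p x"]
  by (simp add: power2_eq_square algebra_simps)

lemma poly_legendre_altdef: "poly (legendre_poly e l) x = (\<Sum>m\<le>2 * l. legendre_coeff e l m * x ^ m)"
  by (simp add: legendre_poly_def poly_sum poly_monom)

lemma legendre_even: "poly (legendre_poly e l) (- x) = poly (legendre_poly e l) x"
  unfolding poly_legendre_altdef
  by (intro sum.cong) (auto simp: legendre_coeff_odd, metis legendre_coeff_odd mult_eq_0_iff power_minus_even)

text \<open>Only even powers occur, with nonnegative coefficients and constant term 1. Having no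
  real zero, the polynomial may be divided by on the whole line in the reduction of order.\<close>

lemma legendre_ge_1: "poly (legendre_poly 1 l) x \<ge> 1"
proof -
  have "legendre_coeff 1 l m * x ^ m \<ge> 0" for m
    by (cases "even m") (auto simp: legendre_coeff_odd legendre_coeff_nonneg zero_le_even_power)
  then have "(\<Sum>m\<in>{0}. legendre_coeff 1 l m * x ^ m) \<le> (\<Sum>m\<le>2 * l. legendre_coeff 1 l m * x ^ m)"
    by (intro sum_mono2) auto
  then show ?thesis by (simp add: poly_legendre_altdef)
qed

text \<open>The degrees are distinct, so the largest index with nonzero weight is alone in
  contributing to its leading power.\<close>

lemma legendre_independent:
  assumes "(\<Sum>l\<le>N. smult (c l) (legendre_poly e l)) = 0" "e \<noteq> 0" "l \<le> N"
  shows "c l = 0"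
proof (rule ccontr)
  assume "c l \<noteq> 0"
  define m where "m = Max {i. i \<le> N \<and> c i \<noteq> 0}"
  have fin: "finite {i. i \<le> N \<and> c i \<noteq> 0}" by simp
  have m: "m \<le> N" "c m \<noteq> 0" using Max_in[OF fin] \<open>c l \<noteq> 0\<close> \<open>l \<le> N\<close> unfolding m_def by blast+
  have big: "c i = 0" if "m < i" "i \<le> N" for i
    using Max_ge[OF fin, of i] that unfolding m_def[symmetric] by auto
  have "0 = coeff (\<Sum>l\<le>N. smult (c l) (legendre_poly e l)) (2 * m)" using assms(1) by simp
  also have "\<dots> = (\<Sum>i\<le>N. c i * legendre_coeff e i (2 * m))" by (simp add: coeff_sum)
  also have "\<dots> = (\<Sum>i\<in>{m}. c i * legendre_coeff e i (2 * m))"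
    using m by (intro sum.mono_neutral_right) (auto, metis big legendre_coeff_eq_0 linorder_neqE_nat mult_less_mono2 zero_less_numeral)
  finally show False using m legendre_coeff_lead[OF assms(2), of m m] by simp
qed

section \<open>Homogeneous linear systems and Taylor estimates at 0\<close>

text \<open>Gaussian elimination, by induction on the set \<open>I\<close> of equations;
  \<open>J\<close> indexes the unknowns.\<close>

lemma exists_nontrivial_solution:
  fixes \<phi> :: "'i \<Rightarrow> 'j \<Rightarrow> real"
  assumes "finite I" "finite J" "card I < card J"
  shows "\<exists>c. (\<exists>l\<in>J. c l \<noteq> 0) \<and> (\<forall>i\<in>I. (\<Sum>l\<in>J. c l * \<phi> i l) = 0)"
  using assms
proof (induction I arbitrary: J \<phi> rule: finite_induct)
  case empty
  then have "J \<noteq> {}" by auto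
  then show ?case by (intro exI[of _ "\<lambda>_. 1"]) auto
next
  case (insert i I)
  show ?case
  proof (cases "\<forall>l\<in>J. \<phi> i l = 0")
    case True
    obtain c where "(\<exists>l\<in>J. c l \<noteq> 0)" "(\<forall>i\<in>I. (\<Sum>l\<in>J. c l * \<phi> i l) = 0)"
      using insert.IH[of J \<phi>] insert.prems insert.hyps by auto
    then show ?thesis using True by (intro exI[of _ c]) auto
  next
    case False
    then obtain l0 where l0: "l0 \<in> J" "\<phi> i l0 \<noteq> 0" by auto
    define J' where "J' = J - {l0}"
    have J': "finite J'" "J = insert l0 J'" "l0 \<notin> J'" using insert.prems l0 by (auto simp: J'_def)
    then have "card I < card J'" using insert.prems insert.hyps by simp
    \<comment> \<open>The pivot \<open>\<phi> i l0\<close> eliminates the unknown \<open>l0\<close>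
      from the remaining equations.\<close>
    from insert.IH[OF J'(1) this, of "\<lambda>i' l. \<phi> i' l - \<phi> i' l0 * \<phi> i l / \<phi> i l0"]
    obtain c where c: "\<exists>l\<in>J'. c l \<noteq> 0"
      "\<And>i'. i' \<in> I \<Longrightarrow> (\<Sum>l\<in>J'. c l * (\<phi> i' l - \<phi> i' l0 * \<phi> i l / \<phi> i l0)) = 0" by auto
    \<comment> \<open>Back substitution: with this value of the unknown \<open>l0\<close>, equation
      \<open>i\<close> holds.\<close>
    define t where "t = - (\<Sum>l\<in>J'. c l * \<phi> i l) / \<phi> i l0"
    define d where "d = c(l0 := t)"
    have sum_d: "(\<Sum>l\<in>J. d l * \<phi> i' l) = t * \<phi> i' l0 + (\<Sum>l\<in>J'. c l * \<phi> i' l)" for i'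
      using J' by (auto simp: d_def intro!: sum.cong)
    have "(\<Sum>l\<in>J. d l * \<phi> i' l) = 0" if "i' \<in> insert i I" for i'
    proof (cases "i' = i")
      case True then show ?thesis using l0 by (simp add: sum_d t_def)
    next
      case False
      then have "(\<Sum>l\<in>J'. c l * (\<phi> i' l - \<phi> i' l0 * \<phi> i l / \<phi> i l0)) = 0" using c that by auto
      moreover have "(\<Sum>l\<in>J'. c l * (\<phi> i' l - \<phi> i' l0 * \<phi> i l / \<phi> i l0)) =
         (\<Sum>l\<in>J'. c l * \<phi> i' l) + t * \<phi> i' l0"
        by (simp add: t_def right_diff_distrib sum_subtractf sum_distrib_left sum_distrib_right sum_divide_distrib mult_ac)
      ultimately show ?thesis by (simp add: sum_d)
    qed
    moreover have "\<exists>l\<in>J. d l \<noteq> 0" using c(1) J' by (auto simp: d_def)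
    ultimately show ?thesis by blast
  qed
qed

text \<open>Splitting off the constant term, p = a + x q, turns order \<open>M\<close> for
  \<open>q\<close> into order \<open>Suc M\<close> for \<open>p\<close>. Order 0 is boundedness on a
  compact interval.\<close>

lemma poly_taylor_bound:
  fixes p :: "real poly"
  shows "\<exists>K\<ge>0. \<forall>x. \<bar>x\<bar> \<le> 1 \<longrightarrow> \<bar>poly p x - (\<Sum>i<M. coeff p i * x ^ i)\<bar> \<le> K * \<bar>x\<bar> ^ M"
proof (induction M arbitrary: p)
  case 0
  have "compact (poly p ` {-1..1})" by (intro compact_continuous_image continuous_intros) auto
  then obtain K where "\<forall>y\<in>poly p ` {-1..1}. norm y \<le> K" using compact_imp_bounded bounded_iff by metis
  then show ?case by (intro exI[of _ "max K 0"]) (auto simp: abs_le_iff le_max_iff_disj)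
next
  case (Suc M)
  obtain a q where p: "p = pCons a q" by (cases p)
  obtain K where K: "K \<ge> 0" "\<And>x. \<bar>x\<bar> \<le> 1 \<Longrightarrow> \<bar>poly q x - (\<Sum>i<M. coeff q i * x ^ i)\<bar> \<le> K * \<bar>x\<bar> ^ M"
    using Suc.IH[of q] by blast
  have "poly p x - (\<Sum>i<Suc M. coeff p i * x ^ i) = x * (poly q x - (\<Sum>i<M. coeff q i * x ^ i))" for x
    unfolding p sum.lessThan_Suc_shift by (simp add: sum_distrib_left algebra_simps)
  then have "\<bar>poly p x - (\<Sum>i<Suc M. coeff p i * x ^ i)\<bar> \<le> K * \<bar>x\<bar> ^ Suc M" if "\<bar>x\<bar> \<le> 1" for x
    using mult_left_mono[OF K(2)[OF that], of "\<bar>x\<bar>"] by (simp add: abs_mult mult_ac)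
  then show ?case using K(1) by blast
qed

lemma poly_bounded_unit:
  fixes p :: "real poly"
  obtains K where "K \<ge> 0" "\<And>x. \<bar>x\<bar> \<le> 1 \<Longrightarrow> \<bar>poly p x\<bar> \<le> K"
  using poly_taylor_bound[of p 0] by auto

lemma exists_poly_antiderivative:
  fixes r :: "real poly"
  shows "\<exists>R. pderiv R = r \<and> poly R 0 = 0"
proof (intro exI conjI)
  let ?R = "\<Sum>i\<le>degree r. monom (coeff r i / real (Suc i)) (Suc i)"
  have "pderiv ?R = (\<Sum>i\<le>degree r. monom (coeff r i) i)"
    by (simp add: higher_pderiv_sum[of 1, simplified] pderiv_monom del: of_nat_Suc)
  then show "pderiv ?R = r" by (simp add: poly_as_sum_of_monoms)
  show "poly ?R 0 = 0" by (simp add: poly_sum poly_monom)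
qed

lemma exists_antiderivative:
  fixes g :: "real \<Rightarrow> real"
  assumes "\<And>x. isCont g x"
  obtains G where "\<And>x. (G has_real_derivative g x) (at x)" "G 0 = 0"
proof -
  obtain F where F: "\<And>x. (F has_vector_derivative g x) (at x)"
    using einterval_antiderivative[of "-\<infinity>" "\<infinity>" g] assms by auto
  show ?thesis
    by (rule that[of "\<lambda>x. F x - F 0"])
       (use F in \<open>auto intro!: derivative_eq_intros simp: has_real_derivative_iff_has_vector_derivative\<close>)
qed

text \<open>With \<open>x E = 1 - D\<close>, the truncated geometric series of \<open>x E\<close> inverts \<open>D\<close> up to \<open>x\<^sup>M\<close>.\<close>

lemma poly_inverse_approx:
  fixes D :: "real poly"
  assumes "poly D 0 = 1"
  shows "\<exists>r E. \<forall>x. 1 - poly r x * poly D x = x ^ M * poly E x"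
proof -
  have "poly (1 - D) 0 = 0" using assms by simp
  then obtain E where E: "1 - D = [:0, 1:] * E" by (metis dvdE minus_zero poly_eq_0_iff_dvd)
  have "1 - poly (\<Sum>i<M. (1 - D) ^ i) x * poly D x = x ^ M * poly (E ^ M) x" for x
  proof -
    have eq: "1 - poly D x = x * poly E x" using arg_cong[OF E, of "\<lambda>p. poly p x"] by simp
    have "poly (\<Sum>i<M. (1 - D) ^ i) x * poly D x = (\<Sum>i<M. (1 - poly D x) ^ i) * (1 - (1 - poly D x))"
      by (simp add: poly_sum)
    also have "\<dots> = 1 - (1 - poly D x) ^ M" by (metis mult.commute one_diff_power_eq)
    finally show ?thesis by (simp add: eq power_mult_distrib)
  qed
  then show ?thesis by blast
qed

text \<open>The integrand is approximated by a polynomial \<open>r\<close> up to order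
  \<open>M\<close>, and the mean value inequality on the ball of radius |x| carries the error over
  to the antiderivatives.\<close>

lemma antiderivative_taylor_bound:
  fixes D :: "real poly"
  assumes G: "\<And>x. (G has_real_derivative 1 / poly D x) (at x)" "G 0 = 0"
    and D: "poly D 0 = 1" "\<And>x. poly D x \<ge> 1"
  shows "\<exists>R K. K \<ge> 0 \<and> (\<forall>x. \<bar>x\<bar> \<le> 1 \<longrightarrow> \<bar>G x - poly R x\<bar> \<le> K * \<bar>x\<bar> ^ M)"
proof -
  obtain r E where rE: "\<And>x. 1 - poly r x * poly D x = x ^ M * poly E x"
    using poly_inverse_approx[OF D(1)] by blast
  obtain K where K: "K \<ge> 0" "\<And>x. \<bar>x\<bar> \<le> 1 \<Longrightarrow> \<bar>poly E x\<bar> \<le> K"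
    using poly_bounded_unit[of E] by blast
  obtain R where R: "pderiv R = r" "poly R 0 = 0" using exists_poly_antiderivative by blast
  define H where "H x = G x - poly R x" for x
  have H: "(H has_real_derivative 1 / poly D x - poly r x) (at x)" for x
    unfolding H_def by (auto intro!: derivative_eq_intros G(1) simp: R(1))
  have bound: "\<bar>1 / poly D x - poly r x\<bar> \<le> K * \<bar>x\<bar> ^ M" if "\<bar>x\<bar> \<le> 1" for x
  proof -
    have "1 / poly D x - poly r x = x ^ M * poly E x / poly D x"
      using rE[of x] D(2)[of x] by (simp add: field_simps)
    then have "\<bar>1 / poly D x - poly r x\<bar> = \<bar>x\<bar> ^ M * \<bar>poly E x\<bar> / poly D x"
      using D(2)[of x] by (simp add: abs_mult power_abs)
    also have "\<dots> \<le> \<bar>x\<bar> ^ M * \<bar>poly E x\<bar>"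
      using D(2)[of x] mult_left_mono[OF D(2)[of x], of "\<bar>x\<bar> ^ M * \<bar>poly E x\<bar>"]
      by (simp add: divide_le_eq)
    also have "\<dots> \<le> \<bar>x\<bar> ^ M * K" using K(2)[OF that] by (intro mult_left_mono) auto
    finally show ?thesis by (simp add: mult.commute)
  qed
  have "\<bar>H x\<bar> \<le> K * \<bar>x\<bar> ^ M" if "\<bar>x\<bar> \<le> 1" for x
  proof -
    have "norm (H x - H 0) \<le> K * \<bar>x\<bar> ^ M * norm (x - 0)"
    proof (rule field_differentiable_bound[where S = "cball 0 \<bar>x\<bar>"])
      show "(H has_field_derivative 1 / poly D z - poly r z) (at z within cball 0 \<bar>x\<bar>)" for z
        using H by (rule has_field_derivative_at_within)
      show "norm (1 / poly D z - poly r z) \<le> K * \<bar>x\<bar> ^ M" if z: "z \<in> cball 0 \<bar>x\<bar>" for z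
      proof -
        have "\<bar>z\<bar> \<le> \<bar>x\<bar>" using z by simp
        then have "K * \<bar>z\<bar> ^ M \<le> K * \<bar>x\<bar> ^ M" using K(1) by (intro mult_left_mono power_mono) auto
        then show ?thesis using bound[of z] \<open>\<bar>z\<bar> \<le> \<bar>x\<bar>\<close> \<open>\<bar>x\<bar> \<le> 1\<close> by simp
      qed
    qed auto
    moreover have "H 0 = 0" using G R by (simp add: H_def)
    \<comment> \<open>Integration gains a factor |x|, which is given away by |x| \<le> 1.\<close>
    moreover have "K * \<bar>x\<bar> ^ M * \<bar>x\<bar> \<le> K * \<bar>x\<bar> ^ M * 1" using that K(1) by (intro mult_left_mono) auto
    ultimately show ?thesis by simp
  qed
  then show ?thesis using K(1) unfolding H_def by blast
qed

section \<open>The odd solution of the radial equation\<close>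

text \<open>For \<open>l = 0\<close> the function \<open>T\<close> is arctan. The last clause asks
  for a finite expansion at 0 of every order instead of a power series: the linear conditions
  imposed later involve finitely many coefficients only.\<close>

definition radial_solution :: "nat \<Rightarrow> (real \<Rightarrow> real) \<Rightarrow> (real \<Rightarrow> real) \<Rightarrow> (real \<Rightarrow> real) \<Rightarrow> bool" where
  "radial_solution l T T1 T2 \<longleftrightarrow>
     (\<forall>s. (T has_real_derivative T1 s) (at s)) \<and> (\<forall>s. (T1 has_real_derivative T2 s) (at s)) \<and>
     (\<forall>s. (1 + s\<^sup>2) * T2 s + 2 * s * T1 s = 2 * real l * (2 * real l + 1) * T s) \<and>
     (\<forall>s. T (- s) = - T s) \<and> T1 0 = 1 \<and>
     (\<forall>M. \<exists>\<tau> K. K \<ge> 0 \<and> (\<forall>s. \<bar>s\<bar> \<le> 1 \<longrightarrow> \<bar>T s - (\<Sum>i<M. \<tau> i * s ^ i)\<bar> \<le> K * \<bar>s\<bar> ^ M))"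

text \<open>Reduction of order: the second solution is the polynomial one times an antiderivative of
  \<open>1 / ((1 + s\<^sup>2) p\<^sup>2)\<close>.\<close>

lemma exists_radial_solution: "\<exists>T T1 T2. radial_solution l T T1 T2"
proof -
  define p where "p = legendre_poly 1 l"
  define D where "D = [:1, 0, 1:] * p\<^sup>2"
  have polyD: "poly D s = (1 + s\<^sup>2) * (poly p s)\<^sup>2" for s by (simp add: D_def power2_eq_square algebra_simps)
  have p1: "poly p s \<ge> 1" for s unfolding p_def by (rule legendre_ge_1)
  have p0: "poly p 0 = 1" by (simp add: p_def poly_0_coeff_0)
  have D1: "poly D s \<ge> 1" for s
    unfolding polyD using mult_mono[of 1 "1 + s\<^sup>2" 1 "(poly p s)\<^sup>2"] p1[of s] one_le_power[of "poly p s" 2] by auto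
  have D0: "poly D 0 = 1" by (simp add: polyD p0)
  have "isCont (\<lambda>x. 1 / poly D x) x" for x using D1[of x] by (intro continuous_intros) auto
  then obtain G where G: "\<And>x. (G has_real_derivative 1 / poly D x) (at x)" "G 0 = 0"
    by (rule exists_antiderivative) blast+
  have G_odd: "G (- s) = - G s" for s
  proof -
    \<comment> \<open>The integrand is even, so \<open>G (- s) + G s\<close> is constant;
      \<open>G 0 = 0\<close> fixes the constant.\<close>
    have "((\<lambda>s. G (- s) + G s) has_real_derivative 0) (at x)" for x
    proof -
      have "poly D (- x) = poly D x" by (simp add: polyD p_def legendre_even)
      then show ?thesis by (auto intro!: derivative_eq_intros DERIV_chain2[OF G(1)] G(1))
    qed
    then have "G (- s) + G s = G (- 0) + G 0" by (intro DERIV_isconst_all allI)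
    then show ?thesis using G(2) by simp
  qed
  define T where "T s = poly p s * G s" for s
  define T1 where "T1 s = poly (pderiv p) s * G s + 1 / ((1 + s\<^sup>2) * poly p s)" for s
  define T2 where "T2 s = poly (pderiv (pderiv p)) s * G s - 2 * s / ((1 + s\<^sup>2)\<^sup>2 * poly p s)" for s
  have nz: "poly p s \<noteq> 0" "1 + s\<^sup>2 \<noteq> 0" for s using p1[of s] by (auto simp: add_nonneg_eq_0_iff)
  have "(T has_real_derivative T1 s) (at s)" for s
    unfolding T_def T1_def using nz[of s]
    by (auto intro!: derivative_eq_intros G(1) simp: polyD power2_eq_square)
  moreover have "(T1 has_real_derivative T2 s) (at s)" for s
  proof -
    have "((\<lambda>s. poly (pderiv p) s * G s + 1 / ((1 + s\<^sup>2) * poly p s)) has_real_derivative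
       poly (pderiv (pderiv p)) s * G s + poly (pderiv p) s * (1 / poly D s)
        + (- (2 * s * poly p s) - poly (pderiv p) s * (1 + s\<^sup>2)) / ((1 + s\<^sup>2) * poly p s)\<^sup>2) (at s)"
      using nz[of s] by (auto intro!: derivative_eq_intros G(1) simp: power2_eq_square)
    \<comment> \<open>The two terms with the derivative of \<open>p\<close> cancel, because the
      integrand carries exactly the factor 1/p^2.\<close>
    moreover have "poly (pderiv p) s * (1 / poly D s)
        + (- (2 * s * poly p s) - poly (pderiv p) s * (1 + s\<^sup>2)) / ((1 + s\<^sup>2) * poly p s)\<^sup>2
        = - 2 * s / ((1 + s\<^sup>2)\<^sup>2 * poly p s)"
      using nz[of s] unfolding polyD by (simp add: divide_simps) (simp add: power2_eq_square algebra_simps)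
    ultimately show ?thesis unfolding T1_def T2_def by (simp add: algebra_simps)
  qed
  moreover have "(1 + s\<^sup>2) * T2 s + 2 * s * T1 s = 2 * real l * (2 * real l + 1) * T s" for s
  proof -
    have "(1 + s\<^sup>2) * T2 s + 2 * s * T1 s
      = ((1 + s\<^sup>2) * poly (pderiv (pderiv p)) s + 2 * s * poly (pderiv p) s) * G s
       - (1 + s\<^sup>2) * (2 * s / ((1 + s\<^sup>2)\<^sup>2 * poly p s)) + 2 * s * (1 / ((1 + s\<^sup>2) * poly p s))"
      by (simp add: T2_def T1_def algebra_simps)
    also have "(1 + s\<^sup>2) * (2 * s / ((1 + s\<^sup>2)\<^sup>2 * poly p s)) = 2 * s * (1 / ((1 + s\<^sup>2) * poly p s))"
      using nz[of s] by (simp add: power2_eq_square)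
    finally show ?thesis using legendre_ode[of 1 s l] by (simp add: T_def p_def)
  qed
  moreover have "T (- s) = - T s" for s by (simp add: T_def G_odd p_def legendre_even)
  moreover have "T1 0 = 1" by (simp add: T1_def G p0)
  moreover have "\<exists>\<tau> K. K \<ge> 0 \<and> (\<forall>s. \<bar>s\<bar> \<le> 1 \<longrightarrow> \<bar>T s - (\<Sum>i<M. \<tau> i * s ^ i)\<bar> \<le> K * \<bar>s\<bar> ^ M)" for M
  proof -
    obtain R K where K: "K \<ge> 0" "\<And>x. \<bar>x\<bar> \<le> 1 \<Longrightarrow> \<bar>G x - poly R x\<bar> \<le> K * \<bar>x\<bar> ^ M"
      using antiderivative_taylor_bound[OF G D0 D1] by blast
    obtain B where B: "B \<ge> 0" "\<And>x. \<bar>x\<bar> \<le> 1 \<Longrightarrow> \<bar>poly p x\<bar> \<le> B"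
      using poly_bounded_unit[of p] by blast
    obtain K' where K': "K' \<ge> 0"
      "\<And>x. \<bar>x\<bar> \<le> 1 \<Longrightarrow> \<bar>poly (p * R) x - (\<Sum>i<M. coeff (p * R) i * x ^ i)\<bar> \<le> K' * \<bar>x\<bar> ^ M"
      using poly_taylor_bound[of "p * R" M] by blast
    have "\<bar>T s - (\<Sum>i<M. coeff (p * R) i * s ^ i)\<bar> \<le> (B * K + K') * \<bar>s\<bar> ^ M" if "\<bar>s\<bar> \<le> 1" for s
    proof -
      have "\<bar>poly p s * (G s - poly R s)\<bar> \<le> B * (K * \<bar>s\<bar> ^ M)"
        unfolding abs_mult using B K that by (intro mult_mono) auto
      moreover have "T s - (\<Sum>i<M. coeff (p * R) i * s ^ i) = poly p s * (G s - poly R s)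
          + (poly (p * R) s - (\<Sum>i<M. coeff (p * R) i * s ^ i))" by (simp add: T_def algebra_simps)
      ultimately show ?thesis using K'(2)[OF that] by (simp only: distrib_right mult.assoc)
    qed
    then show ?thesis using B(1) K(1) K'(1)
      by (intro exI[of _ "coeff (p * R)"] exI[of _ "B * K + K'"]) auto
  qed
  ultimately show ?thesis unfolding radial_solution_def by blast
qed

section \<open>Superpositions that vanish to a prescribed order\<close>

text \<open>The equation is that of Laplace for functions without azimuthal dependence, multiplied
  by s^2 + t^2. The partial derivatives are carried along as data, ready for the chain rule.
  \<open>F\<close> lives on the whole plane, so that any branch of the root can be inserted.\<close>

definition spheroidal_solution ::
  "(complex \<Rightarrow> real) \<Rightarrow> (complex \<Rightarrow> real) \<Rightarrow> (complex \<Rightarrow> real) \<Rightarrow>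
   (complex \<Rightarrow> real) \<Rightarrow> (complex \<Rightarrow> real) \<Rightarrow> (complex \<Rightarrow> real) \<Rightarrow> bool" where
  "spheroidal_solution F F1 F2 F11 F12 F22 \<longleftrightarrow>
     (\<forall>w. (F has_derivative (\<lambda>v. F1 w * Re v + F2 w * Im v)) (at w)) \<and>
     (\<forall>w. (F1 has_derivative (\<lambda>v. F11 w * Re v + F12 w * Im v)) (at w)) \<and>
     (\<forall>w. (F2 has_derivative (\<lambda>v. F12 w * Re v + F22 w * Im v)) (at w)) \<and>
     (\<forall>w. isCont F11 w \<and> isCont F12 w \<and> isCont F22 w) \<and>
     (\<forall>w. (1 + (Re w)\<^sup>2) * F11 w + 2 * Re w * F1 w + (1 - (Im w)\<^sup>2) * F22 w - 2 * Im w * F2 w = 0) \<and>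
     (\<forall>w. F (- w) = - F w)"

lemma has_derivative_separated_sum:
  fixes a b a' b' :: "'l \<Rightarrow> real \<Rightarrow> real"
  assumes "\<And>l x. (a l has_real_derivative a' l x) (at x)" "\<And>l x. (b l has_real_derivative b' l x) (at x)"
  shows "((\<lambda>w. \<Sum>l\<in>J. c l * (a l (Im w) * b l (Re w))) has_derivative
     (\<lambda>v. (\<Sum>l\<in>J. c l * (a l (Im w) * b' l (Re w))) * Re v
         + (\<Sum>l\<in>J. c l * (a' l (Im w) * b l (Re w))) * Im v)) (at w)"
proof -
  have a: "((\<lambda>w. a l (Im w)) has_derivative (\<lambda>v. Im v * a' l (Im w))) (at w)" for l
    by (rule DERIV_compose_FDERIV[OF assms(1)]) (auto intro!: derivative_eq_intros)
  have b: "((\<lambda>w. b l (Re w)) has_derivative (\<lambda>v. Re v * b' l (Re w))) (at w)" for l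
    by (rule DERIV_compose_FDERIV[OF assms(2)]) (auto intro!: derivative_eq_intros)
  show ?thesis
    by (auto intro!: derivative_eq_intros a b
        simp: fun_eq_iff sum_distrib_left sum_distrib_right sum.distrib[symmetric] algebra_simps intro!: sum.cong)
qed

lemma isCont_separated_sum:
  fixes a b :: "'l \<Rightarrow> real \<Rightarrow> real"
  assumes "\<And>l x. isCont (a l) x" "\<And>l x. isCont (b l) x"
  shows "isCont (\<lambda>w. \<Sum>l\<in>J. c l * (a l (Im w) * b l (Re w))) w"
proof -
  have "isCont Re w" "isCont Im w"
    using isCont_Re[OF continuous_ident] isCont_Im[OF continuous_ident] by simp_all
  then show ?thesis
    by (intro continuous_intros isCont_o2[OF _ assms(1)] isCont_o2[OF _ assms(2)])
qed

text \<open>With the Taylor polynomials p of \<open>b0\<close> and q of \<open>a0\<close>, a0 b0 - p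
  q = a0 (b0 - p) + (a0 - q) p, which needs bounds for \<open>a0\<close> and p only. The common
  radius \<open>r\<close> will be |w|.\<close>

lemma separated_sum_bound:
  fixes a b \<alpha> \<beta> :: "nat \<Rightarrow> real"
  assumes "\<bar>a0\<bar> \<le> K1" "\<bar>\<Sum>i<M. \<beta> i * s ^ i\<bar> \<le> K2"
    and "\<bar>a0 - (\<Sum>j<M. \<alpha> j * t ^ j)\<bar> \<le> K3 * \<bar>t\<bar> ^ M"
    and "\<bar>b0 - (\<Sum>i<M. \<beta> i * s ^ i)\<bar> \<le> K4 * \<bar>s\<bar> ^ M"
    and "\<bar>s\<bar> \<le> r" "\<bar>t\<bar> \<le> r" "K3 \<ge> 0" "K4 \<ge> 0"
  shows "\<bar>a0 * b0 - (\<Sum>i<M. \<Sum>j<M. (\<beta> i * \<alpha> j) * (s ^ i * t ^ j))\<bar> \<le> (K1 * K4 + K3 * K2) * r ^ M"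
proof -
  let ?p = "\<Sum>i<M. \<beta> i * s ^ i" and ?q = "\<Sum>j<M. \<alpha> j * t ^ j"
  have "a0 * b0 - ?p * ?q = a0 * (b0 - ?p) + (a0 - ?q) * ?p" by (simp add: algebra_simps)
  moreover have "?p * ?q = (\<Sum>i<M. \<Sum>j<M. (\<beta> i * \<alpha> j) * (s ^ i * t ^ j))"
    unfolding sum_product by (intro sum.cong) (auto simp: mult_ac)
  moreover have "\<bar>a0 * (b0 - ?p)\<bar> \<le> K1 * (K4 * r ^ M)"
  proof -
    have "K4 * \<bar>s\<bar> ^ M \<le> K4 * r ^ M" using assms by (intro mult_left_mono power_mono) auto
    then show ?thesis unfolding abs_mult using assms by (intro mult_mono) auto
  qed
  moreover have "\<bar>(a0 - ?q) * ?p\<bar> \<le> (K3 * r ^ M) * K2"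
  proof -
    have "K3 * \<bar>t\<bar> ^ M \<le> K3 * r ^ M" using assms by (intro mult_left_mono power_mono) auto
    then show ?thesis unfolding abs_mult using assms by (intro mult_mono) auto
  qed
  ultimately show ?thesis by (simp add: algebra_simps)
qed

text \<open>A dimension count: \<open>M * M\<close> Taylor coefficients and one derivative have to
  vanish, and the supply of separated solutions is unlimited.\<close>

lemma exists_spheroidal_solution:
  obtains F F1 F2 F11 F12 F22 K s t where
    "spheroidal_solution F F1 F2 F11 F12 F22" "F1 0 = 0" "F2 0 = 0"
    "\<And>w. norm w \<le> 1 \<Longrightarrow> \<bar>F w\<bar> \<le> K * norm w ^ M"
    "0 < t" "t < 1" "F (Complex s t) \<noteq> 0"
proof -
  obtain T T1 T2 where "\<And>l. radial_solution l (T l) (T1 l) (T2 l)"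
    using exists_radial_solution by metis
  then have T: "(T l has_real_derivative T1 l s) (at s)" "(T1 l has_real_derivative T2 l s) (at s)"
      "(1 + s\<^sup>2) * T2 l s + 2 * s * T1 l s = 2 * real l * (2 * real l + 1) * T l s"
      "T l (- s) = - T l s" "T1 l 0 = 1"
    and T_taylor: "\<exists>\<tau> K. K \<ge> 0 \<and> (\<forall>s. \<bar>s\<bar> \<le> 1 \<longrightarrow> \<bar>T l s - (\<Sum>i<M. \<tau> i * s ^ i)\<bar> \<le> K * \<bar>s\<bar> ^ M)" for l s
    unfolding radial_solution_def by blast+
  have T0: "T l 0 = 0" for l using T(4)[of l 0] by simp
  from T_taylor obtain \<tau> K4 where \<tau>: "\<And>l. K4 l \<ge> 0"
      "\<And>l s. \<bar>s\<bar> \<le> 1 \<Longrightarrow> \<bar>T l s - (\<Sum>i<M. \<tau> l i * s ^ i)\<bar> \<le> K4 l * \<bar>s\<bar> ^ M" by metis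
  \<comment> \<open>Solving the equation for the second derivative shows that it is
    continuous.\<close>
  have T2: "T2 l = (\<lambda>s. (2 * real l * (2 * real l + 1) * T l s - 2 * s * T1 l s) / (1 + s\<^sup>2))" for l
  proof
    fix s :: real
    have "1 + s\<^sup>2 \<noteq> 0" by (simp add: add_nonneg_eq_0_iff)
    then show "T2 l s = (2 * real l * (2 * real l + 1) * T l s - 2 * s * T1 l s) / (1 + s\<^sup>2)"
      using T(3)[of s l] by (simp add: field_simps)
  qed
  have contT: "isCont (T l) s" "isCont (T1 l) s" for l s using T(1,2) DERIV_isCont by blast+
  have contT2: "isCont (T2 l) s" for l s
    unfolding T2 by (intro continuous_intros contT) (simp add: add_nonneg_eq_0_iff)

  define p where "p l = legendre_poly (-1) l" for l
  define A where "A l = poly (p l)" for l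
  define A1 where "A1 l = poly (pderiv (p l))" for l
  define A2 where "A2 l = poly (pderiv (pderiv (p l)))" for l
  have A: "(A l has_real_derivative A1 l t) (at t)" "(A1 l has_real_derivative A2 l t) (at t)"
      "(1 - t\<^sup>2) * A2 l t - 2 * t * A1 l t = - (2 * real l * (2 * real l + 1) * A l t)"
      "A l (- t) = A l t" for l t
    using legendre_ode[of "-1" t l]
    by (auto simp: A_def A1_def A2_def p_def legendre_even intro!: derivative_eq_intros)
  have contA: "isCont (A l) t" "isCont (A1 l) t" "isCont (A2 l) t" for l t
    by (auto simp: A_def A1_def A2_def)
  obtain K3 where K3: "\<And>l. K3 l \<ge> 0"
    "\<And>l t. \<bar>t\<bar> \<le> 1 \<Longrightarrow> \<bar>A l t - (\<Sum>j<M. coeff (p l) j * t ^ j)\<bar> \<le> K3 l * \<bar>t\<bar> ^ M"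
    using poly_taylor_bound[of "p _" M] unfolding A_def by metis
  have "\<exists>K. \<forall>t. \<bar>t\<bar> \<le> 1 \<longrightarrow> \<bar>A l t\<bar> \<le> K" for l
    using poly_bounded_unit[of "p l"] unfolding A_def by blast
  then obtain K1 where K1: "\<And>l t. \<bar>t\<bar> \<le> 1 \<Longrightarrow> \<bar>A l t\<bar> \<le> K1 l" by metis

  \<comment> \<open>One linear condition for each Taylor coefficient, and one for \<open>F1 0 = 0\<close>.\<close>
  define I where "I = insert None (Some ` ({..<M} \<times> {..<M}))"
  define \<phi> where "\<phi> i l = (case i of None \<Rightarrow> A l 0 | Some (i, j) \<Rightarrow> \<tau> l i * coeff (p l) j)" for i l
  have "finite I" by (simp add: I_def)
  \<comment> \<open>\<open>{..card I}\<close> has \<open>card I + 1\<close> elements, one unknown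
    more than there are conditions.\<close>
  then obtain c where c: "\<exists>l\<in>{..card I}. c l \<noteq> 0"
    and c0: "\<And>i. i \<in> I \<Longrightarrow> (\<Sum>l\<le>card I. c l * \<phi> i l) = 0"
    using exists_nontrivial_solution[of I "{..card I}" \<phi>] by auto
  let ?J = "{..card I}"
  define S where "S a b w = (\<Sum>l\<in>?J. c l * (a l (Im w) * b l (Re w)))" for a b :: "nat \<Rightarrow> real \<Rightarrow> real" and w
  have sol: "spheroidal_solution (S A T) (S A T1) (S A1 T) (S A T2) (S A1 T1) (S A2 T)"
    unfolding spheroidal_solution_def
  proof (intro conjI allI)
    fix w
    show "(S A T has_derivative (\<lambda>v. S A T1 w * Re v + S A1 T w * Im v)) (at w)"
      "(S A T1 has_derivative (\<lambda>v. S A T2 w * Re v + S A1 T1 w * Im v)) (at w)"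
      "(S A1 T has_derivative (\<lambda>v. S A1 T1 w * Re v + S A2 T w * Im v)) (at w)"
      unfolding S_def by (intro has_derivative_separated_sum A T)+
    show "isCont (S A T2) w" "isCont (S A1 T1) w" "isCont (S A2 T) w"
      unfolding S_def by (intro isCont_separated_sum contA contT contT2)+
    show "S A T (- w) = - S A T w" by (simp add: S_def A T sum_negf)
    have "(1 + (Re w)\<^sup>2) * S A T2 w + 2 * Re w * S A T1 w + (1 - (Im w)\<^sup>2) * S A2 T w - 2 * Im w * S A1 T w
      = (\<Sum>l\<in>?J. c l * (A l (Im w) * ((1 + (Re w)\<^sup>2) * T2 l (Re w) + 2 * Re w * T1 l (Re w))
          + ((1 - (Im w)\<^sup>2) * A2 l (Im w) - 2 * Im w * A1 l (Im w)) * T l (Re w)))"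
      unfolding S_def sum_distrib_left sum.distrib[symmetric] sum_subtractf[symmetric]
      by (intro sum.cong) (auto simp: algebra_simps)
    also have "\<dots> = 0" unfolding A T by (intro sum.neutral) (auto simp: algebra_simps)
    finally show "(1 + (Re w)\<^sup>2) * S A T2 w + 2 * Re w * S A T1 w + (1 - (Im w)\<^sup>2) * S A2 T w
      - 2 * Im w * S A1 T w = 0" .
  qed
  have F1: "S A T1 0 = 0" using c0[of None] by (simp add: S_def \<phi>_def T I_def)
  \<comment> \<open>This costs no condition, as every \<open>T l\<close> is odd.\<close>
  have F2: "S A1 T 0 = 0" by (simp add: S_def T0)
  have "\<exists>K. \<forall>w. norm w \<le> 1 \<longrightarrow> \<bar>S A T w\<bar> \<le> K * norm w ^ M"
  proof -
    define B where "B l = K1 l * K4 l + K3 l * (\<Sum>i<M. \<bar>\<tau> l i\<bar>)" for l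
    have "\<bar>S A T w\<bar> \<le> (\<Sum>l\<in>?J. \<bar>c l\<bar> * B l) * norm w ^ M" if w: "norm w \<le> 1" for w
    proof -
      \<comment> \<open>\<open>?E l\<close> is the product of the two Taylor polynomials. Weighted
        by \<open>c l\<close> and summed, these cancel monomial by monomial, so only the remainders
        are left to estimate.\<close>
      let ?E = "\<lambda>l. \<Sum>i<M. \<Sum>j<M. (\<tau> l i * coeff (p l) j) * (Re w ^ i * Im w ^ j)"
      let ?X = "\<lambda>l i j. c l * ((\<tau> l i * coeff (p l) j) * (Re w ^ i * Im w ^ j))"
      have "(\<Sum>l\<in>?J. c l * ?E l) = (\<Sum>l\<in>?J. \<Sum>i<M. \<Sum>j<M. ?X l i j)"
        by (simp add: sum_distrib_left)
      also have "\<dots> = (\<Sum>i<M. \<Sum>l\<in>?J. \<Sum>j<M. ?X l i j)" by (rule sum.swap)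
      also have "\<dots> = (\<Sum>i<M. \<Sum>j<M. \<Sum>l\<in>?J. ?X l i j)" by (rule sum.cong[OF refl sum.swap])
      also have "\<dots> = (\<Sum>i<M. \<Sum>j<M. (\<Sum>l\<in>?J. c l * \<phi> (Some (i, j)) l) * (Re w ^ i * Im w ^ j))"
        by (simp add: \<phi>_def sum_distrib_right mult.assoc)
      also have "\<dots> = 0" using c0 by (intro sum.neutral ballI) (auto simp: I_def)
      finally have zero: "(\<Sum>l\<in>?J. c l * ?E l) = 0" .
      have "\<bar>A l (Im w) * T l (Re w) - ?E l\<bar> \<le> B l * norm w ^ M" for l
        unfolding B_def
      proof (rule separated_sum_bound)
        have r: "\<bar>Re w\<bar> \<le> 1" "\<bar>Im w\<bar> \<le> 1" using abs_Re_le_cmod[of w] abs_Im_le_cmod[of w] w by linarith+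
        show "\<bar>A l (Im w)\<bar> \<le> K1 l" using K1 r by blast
        show "\<bar>A l (Im w) - (\<Sum>j<M. coeff (p l) j * Im w ^ j)\<bar> \<le> K3 l * \<bar>Im w\<bar> ^ M" using K3 r by blast
        show "\<bar>T l (Re w) - (\<Sum>i<M. \<tau> l i * Re w ^ i)\<bar> \<le> K4 l * \<bar>Re w\<bar> ^ M" using \<tau> r by blast
        have "\<bar>\<Sum>i<M. \<tau> l i * Re w ^ i\<bar> \<le> (\<Sum>i<M. \<bar>\<tau> l i * Re w ^ i\<bar>)" by (rule sum_abs)
        also have "\<dots> \<le> (\<Sum>i<M. \<bar>\<tau> l i\<bar>)"
          using r by (intro sum_mono) (auto simp: abs_mult power_abs intro!: mult_left_le power_le_one)
        finally show "\<bar>\<Sum>i<M. \<tau> l i * Re w ^ i\<bar> \<le> (\<Sum>i<M. \<bar>\<tau> l i\<bar>)" .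
      qed (use K3 \<tau> abs_Re_le_cmod abs_Im_le_cmod in auto)
      then have "\<bar>c l * (A l (Im w) * T l (Re w) - ?E l)\<bar> \<le> \<bar>c l\<bar> * B l * norm w ^ M" for l
        unfolding abs_mult mult.assoc by (intro mult_left_mono) auto
      then have "\<bar>\<Sum>l\<in>?J. c l * (A l (Im w) * T l (Re w) - ?E l)\<bar> \<le> (\<Sum>l\<in>?J. \<bar>c l\<bar> * B l * norm w ^ M)"
        by (intro order_trans[OF sum_abs] sum_mono) auto
      then show ?thesis using zero by (simp add: right_diff_distrib sum_subtractf S_def sum_distrib_right)
    qed
    then show ?thesis by blast
  qed
  then obtain K where K: "\<And>w. norm w \<le> 1 \<Longrightarrow> \<bar>S A T w\<bar> \<le> K * norm w ^ M" by blast
  \<comment> \<open>The restriction on \<open>t\<close> makes w the coordinate of an actual point of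
    space that is off the circle.\<close>
  have "\<exists>s t. 0 < t \<and> t < 1 \<and> S A T (Complex s t) \<noteq> 0"
  proof (rule ccontr)
    assume "\<not> ?thesis"
    then have 0: "S A T (Complex s t) = 0" if "0 < t" "t < 1" for s t using that by blast
    define P where "P = (\<Sum>l\<in>?J. smult (c l) (p l))"
    have "poly P t = 0" if t: "0 < t" "t < 1" for t
    proof -
      \<comment> \<open>Differentiating in s at 0 removes the radial factors, since
        \<open>T1 l 0 = 1\<close>, and leaves the polynomial \<open>P\<close> in t.\<close>
      have "((\<lambda>s. \<Sum>l\<in>?J. c l * (A l t * T l s)) has_real_derivative (\<Sum>l\<in>?J. c l * (A l t * T1 l 0))) (at 0)"
        by (auto intro!: derivative_eq_intros T(1) simp: mult_ac)
      moreover have "(\<lambda>s. \<Sum>l\<in>?J. c l * (A l t * T l s)) = (\<lambda>s. 0)" using 0[OF t] by (auto simp: S_def fun_eq_iff)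
      ultimately have "(\<Sum>l\<in>?J. c l * (A l t * T1 l 0)) = 0" using DERIV_unique[OF _ DERIV_const] by simp
      then show ?thesis by (simp add: P_def poly_sum T A_def)
    qed
    then have "{0<..<1} \<subseteq> {t. poly P t = 0}" by auto
    then have "infinite {t. poly P t = 0}" using infinite_Ioo[OF zero_less_one] by (rule infinite_super)
    then have "P = 0" using poly_roots_finite by blast
    then have "(\<Sum>l\<le>card I. smult (c l) (legendre_poly (-1) l)) = 0" by (simp add: P_def p_def)
    then show False using c legendre_independent[of c "-1" "card I"] by force
  qed
  then obtain s t where "0 < t" "t < 1" "S A T (Complex s t) \<noteq> 0" by blast
  then show ?thesis using that[OF sol F1 F2 K] by blast
qed

section \<open>Pulling back to space\<close>

text \<open>For a unit vector \<open>n\<close> this is the bilinear (not Hermitian) square of the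
  complex vector x - a + i n: the squared distance to a centre displaced in an imaginary
  direction.\<close>

definition complex_dist_sq :: "real ^ 3 \<Rightarrow> real ^ 3 \<Rightarrow> real ^ 3 \<Rightarrow> complex" where
  "complex_dist_sq a n x = Complex ((x - a) \<bullet> (x - a) - 1) (2 * ((x - a) \<bullet> n))"

text \<open>Obtained from 2 w dw = dz. The direction precedes the point, so that fixing it gives a
  function that can be differentiated again.\<close>

definition root_derivative :: "real ^ 3 \<Rightarrow> real ^ 3 \<Rightarrow> (real ^ 3 \<Rightarrow> complex) \<Rightarrow> real ^ 3 \<Rightarrow> real ^ 3 \<Rightarrow> complex" where
  "root_derivative a n w v x = Complex ((x - a) \<bullet> v) (n \<bullet> v) / w x"

definition root_branch :: "real ^ 3 \<Rightarrow> real ^ 3 \<Rightarrow> (real ^ 3) set \<Rightarrow> (real ^ 3 \<Rightarrow> complex) \<Rightarrow> bool" where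
  "root_branch a n N w \<longleftrightarrow> open N \<and>
     (\<forall>x\<in>N. w x \<noteq> 0 \<and> (w x)\<^sup>2 = complex_dist_sq a n x \<and>
        (w has_derivative (\<lambda>v. root_derivative a n w v x)) (at x))"

lemma has_derivative_Complex_inner:
  "((\<lambda>x. Complex ((x - a) \<bullet> b) c) has_derivative (\<lambda>v. Complex (v \<bullet> b) 0)) (at x)"
  unfolding Complex_eq by (auto intro!: derivative_eq_intros)

lemma has_derivative_complex_dist_sq:
  "(complex_dist_sq a n has_derivative (\<lambda>v. 2 * Complex ((x - a) \<bullet> v) (n \<bullet> v))) (at x)"
  unfolding complex_dist_sq_def Complex_eq
  by (auto intro!: derivative_eq_intros simp: fun_eq_iff algebra_simps inner_commute)

lemma root_branch_subset: "root_branch a n N w \<Longrightarrow> open M \<Longrightarrow> M \<subseteq> N \<Longrightarrow> root_branch a n M w"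
  by (auto simp: root_branch_def)

lemma root_branch_uminus:
  assumes "root_branch a n N w" shows "root_branch a n N (\<lambda>x. - w x)"
  unfolding root_branch_def
proof (intro conjI ballI)
  fix x assume "x \<in> N"
  then have w: "w x \<noteq> 0" "(w x)\<^sup>2 = complex_dist_sq a n x"
    "(w has_derivative (\<lambda>v. root_derivative a n w v x)) (at x)" using assms by (auto simp: root_branch_def)
  show "((\<lambda>x. - w x) has_derivative (\<lambda>v. root_derivative a n (\<lambda>x. - w x) v x)) (at x)"
    using has_derivative_minus[OF w(3)] by (simp add: root_derivative_def)
qed (use assms in \<open>auto simp: root_branch_def\<close>)

lemma root_branch_csqrt:
  assumes "open N" "\<And>x. x \<in> N \<Longrightarrow> complex_dist_sq a n x \<notin> \<real>\<^sub>\<le>\<^sub>0"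
  shows "root_branch a n N (\<lambda>x. csqrt (complex_dist_sq a n x))"
  unfolding root_branch_def
proof (intro conjI ballI)
  fix x assume x: "x \<in> N"
  show c: "csqrt (complex_dist_sq a n x) \<noteq> 0" using assms(2)[OF x] by auto
  show "((\<lambda>x. csqrt (complex_dist_sq a n x)) has_derivative
     (\<lambda>v. root_derivative a n (\<lambda>x. csqrt (complex_dist_sq a n x)) v x)) (at x)"
    by (rule has_derivative_eq_rhs[OF has_derivative_compose[OF has_derivative_complex_dist_sq
          has_field_derivative_imp_has_derivative[OF has_field_derivative_csqrt[OF assms(2)[OF x]]]]])
       (use c in \<open>auto simp: root_derivative_def fun_eq_iff field_simps\<close>)
qed (use assms in auto)

text \<open>This branch has its cut on the nonnegative reals. It is the one that crosses the open
  disc, where the squared complex distance is negative.\<close>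

lemma root_branch_csqrt_minus:
  assumes "open N" "\<And>x. x \<in> N \<Longrightarrow> - complex_dist_sq a n x \<notin> \<real>\<^sub>\<le>\<^sub>0"
  shows "root_branch a n N (\<lambda>x. \<i> * csqrt (- complex_dist_sq a n x))"
  unfolding root_branch_def
proof (intro conjI ballI)
  fix x assume x: "x \<in> N"
  let ?c = "csqrt (- complex_dist_sq a n x)"
  have c: "?c \<noteq> 0" using assms(2)[OF x] by auto
  have "((\<lambda>x. csqrt (- complex_dist_sq a n x)) has_derivative
      (\<lambda>v. inverse (2 * ?c) * - (2 * Complex ((x - a) \<bullet> v) (n \<bullet> v)))) (at x)"
    by (rule has_derivative_compose[OF has_derivative_minus[OF has_derivative_complex_dist_sq]
          has_field_derivative_imp_has_derivative[OF has_field_derivative_csqrt[OF assms(2)[OF x]]]])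
  from has_derivative_mult_right[OF this, of \<i>]
  show "((\<lambda>x. \<i> * csqrt (- complex_dist_sq a n x)) has_derivative
     (\<lambda>v. root_derivative a n (\<lambda>x. \<i> * csqrt (- complex_dist_sq a n x)) v x)) (at x)"
    by (rule has_derivative_eq_rhs) (use c in \<open>auto simp: root_derivative_def fun_eq_iff field_simps\<close>)
  show "\<i> * csqrt (- complex_dist_sq a n x) \<noteq> 0" using c by simp
qed (use assms in \<open>auto simp: power_mult_distrib\<close>)

section \<open>Laplacian and gradient of a function of the root\<close>

text \<open>\<open>g\<close> is tied to \<open>F\<close> on \<open>N\<close> only: it stands for the
  coordinate of a section in a trivialization, which is expressed by a branch of the root just near
  a given point.\<close>

locale spheroidal_pullback =
  fixes a n :: "real ^ 3" and N :: "(real ^ 3) set" and w :: "real ^ 3 \<Rightarrow> complex"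
    and F F1 F2 F11 F12 F22 :: "complex \<Rightarrow> real" and g :: "real ^ 3 \<Rightarrow> real"
  assumes norm_n: "norm n = 1" and branch: "root_branch a n N w"
    and sol: "spheroidal_solution F F1 F2 F11 F12 F22" and g_eq: "\<And>x. x \<in> N \<Longrightarrow> g x = F (w x)"
begin

abbreviation "D \<equiv> root_derivative a n w"

lemma open_N: "open N" using branch by (simp add: root_branch_def)

lemma w_props:
  assumes "x \<in> N"
  shows "w x \<noteq> 0" "(w x)\<^sup>2 = complex_dist_sq a n x" "(w has_derivative (\<lambda>v. D v x)) (at x)"
  using branch assms by (auto simp: root_branch_def)

lemma continuous_on_w: "continuous_on N w"
  using w_props(3) by (meson continuous_at_imp_continuous_on has_derivative_continuous)

lemma continuous_on_D: "continuous_on N (D v)"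
  unfolding root_derivative_def Complex_eq
  by (intro continuous_intros continuous_on_w) (use w_props in auto)

text \<open>Differentiating the identity w D(b) = (x - a) \<bullet> b + i (n \<bullet> b) along v
  gives D(v) D(b) + w dD(b) = v \<bullet> b.\<close>

lemma has_derivative_D:
  assumes "x \<in> N"
  shows "(D b has_derivative (\<lambda>v. (Complex (v \<bullet> b) 0 - D b x * D v x) / w x)) (at x)"
proof -
  have "((\<lambda>x. Complex ((x - a) \<bullet> b) (n \<bullet> b) / w x) has_derivative
     (\<lambda>v. - Complex ((x - a) \<bullet> b) (n \<bullet> b) * (inverse (w x) * D v x * inverse (w x)) + Complex (v \<bullet> b) 0 / w x)) (at x)"
    by (intro has_derivative_divide has_derivative_Complex_inner w_props assms)
  then show ?thesis
    unfolding root_derivative_def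
    by (rule has_derivative_eq_rhs) (use w_props[OF assms] in \<open>auto simp: fun_eq_iff field_simps\<close>)
qed

lemma F_derivs:
  "(F has_derivative (\<lambda>v. F1 z * Re v + F2 z * Im v)) (at z)"
  "(F1 has_derivative (\<lambda>v. F11 z * Re v + F12 z * Im v)) (at z)"
  "(F2 has_derivative (\<lambda>v. F12 z * Re v + F22 z * Im v)) (at z)"
  "isCont F11 z" "isCont F12 z" "isCont F22 z"
  "(1 + (Re z)\<^sup>2) * F11 z + 2 * Re z * F1 z + (1 - (Im z)\<^sup>2) * F22 z - 2 * Im z * F2 z = 0"
  using sol by (auto simp: spheroidal_solution_def)

lemma has_derivative_g:
  assumes "x \<in> N"
  shows "(g has_derivative (\<lambda>v. F1 (w x) * Re (D v x) + F2 (w x) * Im (D v x))) (at x)"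
proof (rule has_derivative_transform_within_open[OF _ open_N assms])
  show "((\<lambda>x. F (w x)) has_derivative (\<lambda>v. F1 (w x) * Re (D v x) + F2 (w x) * Im (D v x))) (at x)"
    by (rule has_derivative_compose[OF w_props(3)[OF assms] F_derivs(1)])
qed (use g_eq in auto)

lemma partial_g: "x \<in> N \<Longrightarrow> partial b g x = F1 (w x) * Re (D b x) + F2 (w x) * Im (D b x)"
  unfolding partial_def using frechet_derivative_at[OF has_derivative_g, of x] by (metis (no_types, lifting))

definition "second_partial b v x =
   (F11 (w x) * Re (D v x) + F12 (w x) * Im (D v x)) * Re (D b x)
   + F1 (w x) * Re ((Complex (v \<bullet> b) 0 - D b x * D v x) / w x)
   + ((F12 (w x) * Re (D v x) + F22 (w x) * Im (D v x)) * Im (D b x)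
   + F2 (w x) * Im ((Complex (v \<bullet> b) 0 - D b x * D v x) / w x))"

lemma has_derivative_partial_g:
  assumes "x \<in> N"
  shows "(partial b g has_derivative (\<lambda>v. second_partial b v x)) (at x)"
proof (rule has_derivative_transform_within_open[OF _ open_N assms])
  note F = has_derivative_compose[OF w_props(3)[OF assms] F_derivs(2)]
    has_derivative_compose[OF w_props(3)[OF assms] F_derivs(3)]
  note D = has_derivative_D[OF assms, of b]
  show "((\<lambda>x. F1 (w x) * Re (D b x) + F2 (w x) * Im (D b x)) has_derivative (\<lambda>v. second_partial b v x)) (at x)"
    unfolding second_partial_def
    by (rule has_derivative_eq_rhs[OF has_derivative_add[OF
            has_derivative_mult[OF F(1) bounded_linear.has_derivative[OF bounded_linear_Re D]]
            has_derivative_mult[OF F(2) bounded_linear.has_derivative[OF bounded_linear_Im D]]]])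
       (auto simp: fun_eq_iff)
qed (simp add: partial_g)

lemma partial_partial_g: "x \<in> N \<Longrightarrow> partial c (partial b g) x = second_partial b c x"
  unfolding partial_def[of c] using frechet_derivative_at[OF has_derivative_partial_g, of x] by (metis (no_types, lifting))

lemma continuous_on_F: "continuous_on N (\<lambda>x. F1 (w x))" "continuous_on N (\<lambda>x. F2 (w x))"
  "continuous_on N (\<lambda>x. F11 (w x))" "continuous_on N (\<lambda>x. F12 (w x))" "continuous_on N (\<lambda>x. F22 (w x))"
proof -
  have "continuous_on UNIV F1" "continuous_on UNIV F2" "continuous_on UNIV F11" "continuous_on UNIV F12"
    "continuous_on UNIV F22"
    using F_derivs has_derivative_continuous continuous_at_imp_continuous_on by metis+
  then show "continuous_on N (\<lambda>x. F1 (w x))" "continuous_on N (\<lambda>x. F2 (w x))"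
    "continuous_on N (\<lambda>x. F11 (w x))" "continuous_on N (\<lambda>x. F12 (w x))" "continuous_on N (\<lambda>x. F22 (w x))"
    using continuous_on_compose2[OF _ continuous_on_w] by blast+
qed

lemma continuous_on_second_partial: "continuous_on N (second_partial b c)"
  unfolding second_partial_def
  by (intro continuous_intros continuous_on_F continuous_on_D continuous_on_w) (use w_props in auto)

text \<open>A complex eikonal equation: the squares of the numerators add up to the squared complex
  distance, hence to w^2. In real terms, grad s and grad t are orthogonal and |grad s|^2 - |grad
  t|^2 = 1.\<close>

lemma sum_D_sq: "x \<in> N \<Longrightarrow> (\<Sum>b\<in>Basis. (D b x)\<^sup>2) = 1"
proof -
  assume x: "x \<in> N"
  let ?q = "x - a"
  have "(\<Sum>b\<in>Basis. (Complex (?q \<bullet> b) (n \<bullet> b))\<^sup>2) =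
     Complex (\<Sum>b\<in>Basis. (?q \<bullet> b) * (?q \<bullet> b) - (n \<bullet> b) * (n \<bullet> b)) (2 * (\<Sum>b\<in>Basis. (?q \<bullet> b) * (n \<bullet> b)))"
    by (simp add: complex_eq_iff Re_sum Im_sum power2_eq_square sum_distrib_left mult_ac)
  also have "\<dots> = complex_dist_sq a n x"
    using norm_n by (simp add: complex_dist_sq_def sum_subtractf euclidean_inner[symmetric] norm_eq_1)
  finally have "(\<Sum>b\<in>Basis. (Complex (?q \<bullet> b) (n \<bullet> b))\<^sup>2) = complex_dist_sq a n x" .
  moreover have "complex_dist_sq a n x \<noteq> 0" using w_props(1,2)[OF x] by (metis power_not_zero)
  ultimately show ?thesis using w_props(2)[OF x]
    by (simp add: root_derivative_def power_divide flip: sum_divide_distrib)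
qed

text \<open>This is |grad s|^2 + |grad t|^2; together with the difference from
  \<open>sum_D_sq\<close> it determines both lengths.\<close>

lemma sum_norm_D_sq: "x \<in> N \<Longrightarrow> (\<Sum>b\<in>Basis. (norm (D b x))\<^sup>2) = ((x - a) \<bullet> (x - a) + 1) / (norm (w x))\<^sup>2"
proof -
  have "(\<Sum>b\<in>Basis. ((x - a) \<bullet> b)\<^sup>2 + (n \<bullet> b)\<^sup>2) = (x - a) \<bullet> (x - a) + n \<bullet> n"
    by (simp add: sum.distrib euclidean_inner[of "x - a" "x - a"] euclidean_inner[of n n] power2_eq_square)
  then show ?thesis using norm_n
    by (simp add: root_derivative_def norm_divide power_divide norm_eq_1 cmod_power2 flip: sum_divide_distrib)
qed

text \<open>Put \<sigma> = s^2 + t^2. Then |grad s|^2 = (1 + s^2)/\<sigma>, |grad t|^2 = (1 -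
  t^2)/\<sigma>, the gradients are orthogonal, and the Laplacian of w is 2/w. By the chain rule the
  Laplacian of F(w) is the left side of the spheroidal equation divided by \<sigma>.\<close>

lemma laplacian_g: assumes "x \<in> N" shows "laplacian g x = 0"
proof -
  define s t \<sigma> where "s = Re (w x)" and "t = Im (w x)" and "\<sigma> = s\<^sup>2 + t\<^sup>2"
  have \<sigma>: "\<sigma> = (norm (w x))\<^sup>2" "\<sigma> \<noteq> 0" using w_props(1)[OF assms]
    by (auto simp: \<sigma>_def s_def t_def cmod_power2 complex_neq_0)
  have q: "(x - a) \<bullet> (x - a) = 1 + s\<^sup>2 - t\<^sup>2"
    using arg_cong[OF w_props(2)[OF assms], of Re] by (simp add: complex_dist_sq_def s_def t_def Re_power2)
  define R I M where "R = (\<Sum>b\<in>Basis. (Re (D b x))\<^sup>2)" and "I = (\<Sum>b\<in>Basis. (Im (D b x))\<^sup>2)"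
    and "M = (\<Sum>b\<in>Basis. Re (D b x) * Im (D b x))"
  have "R - I = 1" using arg_cong[OF sum_D_sq[OF assms], of Re]
    by (simp add: R_def I_def Re_sum Re_power2 sum_subtractf)
  moreover have M: "M = 0" using arg_cong[OF sum_D_sq[OF assms], of Im]
    by (simp add: M_def Im_sum Im_power2 mult.assoc flip: sum_distrib_left)
  moreover have "R + I = (2 + s\<^sup>2 - t\<^sup>2) / \<sigma>" using sum_norm_D_sq[OF assms]
    by (simp add: R_def I_def cmod_power2 sum.distrib q \<sigma>(1))
  ultimately have "2 * R = (2 + s\<^sup>2 - t\<^sup>2) / \<sigma> + 1" "2 * I = (2 + s\<^sup>2 - t\<^sup>2) / \<sigma> - 1" by linarith+
  moreover have "(2 + s\<^sup>2 - t\<^sup>2) / \<sigma> = 2 * ((1 + s\<^sup>2) / \<sigma>) - 1" "(2 + s\<^sup>2 - t\<^sup>2) / \<sigma> = 2 * ((1 - t\<^sup>2) / \<sigma>) + 1"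
    using \<sigma>(2) by (simp_all add: field_simps) (simp_all add: \<sigma>_def algebra_simps)
  ultimately have R: "R = (1 + s\<^sup>2) / \<sigma>" and I: "I = (1 - t\<^sup>2) / \<sigma>" by linarith+
  \<comment> \<open>The numerator is 3 - 1: the dimension of space minus the eikonal sum.\<close>
  have "(\<Sum>b\<in>Basis. (Complex (b \<bullet> b) 0 - D b x * D b x) / w x) = 2 / w x"
  proof -
    have "(\<Sum>b\<in>Basis. Complex (b \<bullet> b) 0 - D b x * D b x) = (\<Sum>b\<in>(Basis :: (real ^ 3) set). 1) - (\<Sum>b\<in>Basis. (D b x)\<^sup>2)"
      by (simp add: sum_subtractf power2_eq_square inner_Basis complex_eq_iff Re_sum Im_sum)
    then show ?thesis using sum_D_sq[OF assms] by (simp flip: sum_divide_distrib)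
  qed
  then have DD: "(\<Sum>b\<in>Basis. Re ((Complex (b \<bullet> b) 0 - D b x * D b x) / w x)) = 2 * s / \<sigma>"
    "(\<Sum>b\<in>Basis. Im ((Complex (b \<bullet> b) 0 - D b x * D b x) / w x)) = - 2 * t / \<sigma>"
    by (simp_all flip: Re_sum Im_sum) (simp_all add: Re_divide Im_divide s_def t_def \<sigma>_def)
  have "laplacian g x = (\<Sum>b\<in>Basis. second_partial b b x)"
    using partial_partial_g[OF assms] by (simp add: laplacian_def)
  also have "\<dots> = F11 (w x) * R + F12 (w x) * (2 * M) + F22 (w x) * I
     + F1 (w x) * (\<Sum>b\<in>Basis. Re ((Complex (b \<bullet> b) 0 - D b x * D b x) / w x))
     + F2 (w x) * (\<Sum>b\<in>Basis. Im ((Complex (b \<bullet> b) 0 - D b x * D b x) / w x))"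
    unfolding second_partial_def R_def I_def M_def sum_distrib_left sum.distrib[symmetric]
    by (intro sum.cong) (auto simp: algebra_simps power2_eq_square)
  also have "\<dots> = ((1 + s\<^sup>2) * F11 (w x) + 2 * s * F1 (w x) + (1 - t\<^sup>2) * F22 (w x) - 2 * t * F2 (w x)) / \<sigma>"
    unfolding DD R I M using \<sigma>(2) by (simp add: field_simps)
  also have "\<dots> = 0" using F_derivs(7)[of "w x"] by (simp add: s_def t_def)
  finally show ?thesis .
qed

lemma harmonic_on_g: "harmonic_on N g"
  unfolding harmonic_on_def C2_on_def
proof (intro conjI ballI)
  show "g differentiable_on N"
    by (meson differentiable_on_def has_derivative_g differentiableI differentiable_at_withinI)
  show "partial b g differentiable_on N" for b
    by (meson differentiable_on_def has_derivative_partial_g differentiableI differentiable_at_withinI)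
  show "continuous_on N (partial b (partial c g))" for b c
    using continuous_on_second_partial by (rule continuous_on_eq) (simp add: partial_partial_g)
qed (rule laplacian_g)

lemma differentiable_g: "x \<in> N \<Longrightarrow> g differentiable (at x)"
  using has_derivative_g differentiableI by blast

lemma continuous_on_gradient_g: "continuous_on N (gradient g)"
proof -
  have "continuous_on N (\<lambda>x. \<Sum>b\<in>Basis. (F1 (w x) * Re (D b x) + F2 (w x) * Im (D b x)) *\<^sub>R b)"
    by (intro continuous_intros continuous_on_F continuous_on_D)
  then show ?thesis by (rule continuous_on_eq) (simp add: gradient_def partial_g)
qed

text \<open>The factor |w| in the bounds for \<open>F1\<close> and \<open>F2\<close> cancels the
  1/|w| in \<open>D\<close>, so the estimate is uniform up to the circle. The 6 counts three basis
  vectors with two terms each.\<close>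

lemma norm_gradient_g_le:
  assumes "x \<in> N" "\<bar>F1 (w x)\<bar> \<le> K * norm (w x)" "\<bar>F2 (w x)\<bar> \<le> K * norm (w x)"
  shows "norm (gradient g x) \<le> 6 * K * (norm (x - a) + 1)"
proof -
  have w: "norm (w x) > 0" using w_props(1)[OF assms(1)] by simp
  have K: "K \<ge> 0" using assms(2) w by (meson abs_ge_zero order_trans zero_le_mult_iff linorder_not_less)
  have "norm (partial b g x *\<^sub>R b) \<le> 2 * K * (norm (x - a) + 1)" if b: "b \<in> Basis" for b
  proof -
    have "norm (Complex ((x - a) \<bullet> b) (n \<bullet> b)) \<le> \<bar>(x - a) \<bullet> b\<bar> + \<bar>n \<bullet> b\<bar>"
      using cmod_le[of "Complex ((x - a) \<bullet> b) (n \<bullet> b)"] by simp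
    also have "\<dots> \<le> norm (x - a) + 1"
      using Basis_le_norm[OF b, of "x - a"] Basis_le_norm[OF b, of n] norm_n by linarith
    finally have D: "norm (D b x) * norm (w x) \<le> norm (x - a) + 1"
      using w by (simp add: root_derivative_def norm_divide)
    have "\<bar>F1 (w x) * Re (D b x)\<bar> \<le> (K * norm (w x)) * norm (D b x)"
      "\<bar>F2 (w x) * Im (D b x)\<bar> \<le> (K * norm (w x)) * norm (D b x)"
      unfolding abs_mult using assms abs_Re_le_cmod abs_Im_le_cmod K w by (intro mult_mono; simp)+
    then have "\<bar>partial b g x\<bar> \<le> 2 * (K * (norm (D b x) * norm (w x)))"
      unfolding partial_g[OF assms(1)] by (simp add: mult_ac)
    also have "\<dots> \<le> 2 * (K * (norm (x - a) + 1))" using D K by (intro mult_left_mono) auto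
    finally show ?thesis using b by simp
  qed
  then have "norm (gradient g x) \<le> (\<Sum>b\<in>(Basis :: (real ^ 3) set). 2 * K * (norm (x - a) + 1))"
    unfolding gradient_def by (intro order_trans[OF norm_sum] sum_mono) auto
  then show ?thesis by simp
qed

end

lemma harmonic_on_locally:
  assumes "\<And>x. x \<in> U \<Longrightarrow> \<exists>N. open N \<and> x \<in> N \<and> harmonic_on N g"
  shows "harmonic_on U g"
proof -
  have *: "g differentiable (at x)" "b \<in> Basis \<Longrightarrow> partial b g differentiable (at x)"
      "b \<in> Basis \<Longrightarrow> c \<in> Basis \<Longrightarrow> isCont (partial b (partial c g)) x" "laplacian g x = 0"
    if "x \<in> U" for x b c
  proof -
    obtain N where "open N" "x \<in> N" "harmonic_on N g" using assms \<open>x \<in> U\<close> by blast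
    then show "g differentiable (at x)" "b \<in> Basis \<Longrightarrow> partial b g differentiable (at x)"
      "b \<in> Basis \<Longrightarrow> c \<in> Basis \<Longrightarrow> isCont (partial b (partial c g)) x" "laplacian g x = 0"
      unfolding harmonic_on_def C2_on_def
      using differentiable_on_eq_differentiable_at[OF \<open>open N\<close>] continuous_on_eq_continuous_at[OF \<open>open N\<close>]
      by meson+
  qed
  then show ?thesis
    unfolding harmonic_on_def C2_on_def differentiable_on_def
    by (blast intro: differentiable_at_withinI continuous_at_imp_continuous_on)
qed

text \<open>The mean value inequality on a ball. Meant for \<open>F1\<close> and \<open>F2\<close>,
  which vanish at 0, to supply the bounds of \<open>norm_gradient_g_le\<close>.\<close>

lemma continuous_derivative_linear_bound:
  fixes G G1 G2 :: "complex \<Rightarrow> real"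
  assumes "\<And>w. (G has_derivative (\<lambda>v. G1 w * Re v + G2 w * Im v)) (at w)"
    and "\<And>w. isCont G1 w" "\<And>w. isCont G2 w" and "G 0 = 0"
  shows "\<exists>K. \<forall>w. norm w \<le> R \<longrightarrow> \<bar>G w\<bar> \<le> K * norm w"
proof -
  have "compact ((\<lambda>w. \<bar>G1 w\<bar> + \<bar>G2 w\<bar>) ` cball 0 R)"
    using assms(2,3) by (intro compact_continuous_image continuous_intros continuous_at_imp_continuous_on) auto
  from compact_imp_bounded[OF this] obtain K where
    "\<And>w. w \<in> cball 0 R \<Longrightarrow> norm (\<bar>G1 w\<bar> + \<bar>G2 w\<bar>) \<le> K" unfolding bounded_iff by blast
  then have K: "\<bar>G1 w\<bar> + \<bar>G2 w\<bar> \<le> K" if "norm w \<le> R" for w using that by force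
  have "norm (G w - G 0) \<le> K * norm (w - 0)" if "norm w \<le> R" for w
  proof (rule differentiable_bound[where S = "cball 0 R"])
    show "(G has_derivative (\<lambda>v. G1 w * Re v + G2 w * Im v)) (at w within cball 0 R)" for w
      using assms(1) by (rule has_derivative_at_withinI)
    show "onorm (\<lambda>v. G1 z * Re v + G2 z * Im v) \<le> K" if "z \<in> cball 0 R" for z
    proof (rule onorm_le)
      fix v
      have "norm (G1 z * Re v + G2 z * Im v) \<le> \<bar>G1 z\<bar> * \<bar>Re v\<bar> + \<bar>G2 z\<bar> * \<bar>Im v\<bar>"
        by (simp flip: abs_mult)
      also have "\<dots> \<le> \<bar>G1 z\<bar> * norm v + \<bar>G2 z\<bar> * norm v"
        by (intro add_mono mult_left_mono abs_Re_le_cmod abs_Im_le_cmod) auto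
      also have "\<dots> \<le> K * norm v" using K[of z] that by (simp add: mult_right_mono flip: distrib_right)
      finally show "norm (G1 z * Re v + G2 z * Im v) \<le> K * norm v" .
    qed
  qed (use that in \<open>auto simp: norm_le_zero_iff intro: order_trans[OF norm_ge_zero]\<close>)
  then show ?thesis using assms(4) by auto
qed

section \<open>Flat sections\<close>

text \<open>A uniform \<epsilon>-neighbourhood of \<open>K\<close> is the Minkowski sum of
  \<open>K\<close> and a ball, hence convex.\<close>

lemma convex_open_neighbourhood:
  fixes K W :: "'a::real_normed_vector set"
  assumes "compact K" "convex K" "open W" "K \<subseteq> W"
  shows "\<exists>V. open V \<and> convex V \<and> K \<subseteq> V \<and> V \<subseteq> W"
proof -
  obtain e where e: "e > 0" "(\<Union>x\<in>K. ball x e) \<subseteq> W"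
    using compact_subset_open_imp_ball_epsilon_subset[OF assms(1,3,4)] by blast
  have "(\<Union>x\<in>K. ball x e) = (\<Union>x\<in>K. \<Union>y\<in>ball 0 e. {x + y})"
    by (auto simp: dist_norm norm_minus_commute) (metis add.commute diff_add_cancel dist_0_norm dist_norm mem_ball)
  then have "convex (\<Union>x\<in>K. ball x e)" using convex_sums[OF assms(2) convex_ball] by simp
  then show ?thesis using e by (intro exI[of _ "\<Union>x\<in>K. ball x e"]) auto
qed

text \<open>Scalar multiplication in the fibre, read off in an arbitrary trivialization because
  \<open>'e\<close> carries no linear structure. The choice is immaterial: transition signs commute
  with multiplication.\<close>

definition fibre_scale :: "'e line_bundle \<Rightarrow> real ^ 3 \<Rightarrow> real \<Rightarrow> 'e \<Rightarrow> 'e" where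
  "fibre_scale L x c e =
     (let \<phi> = snd (SOME p. p \<in> trivs L \<and> x \<in> fst p) in \<phi> x (c * inv (\<phi> x) e))"

text \<open>A flat section of length one over \<open>V\<close>. Constancy is required on a full
  neighbourhood of each point, so the property is local and passes to unions.\<close>

definition flat_unit :: "'e line_bundle \<Rightarrow> (real ^ 3) set \<Rightarrow> (real ^ 3 \<Rightarrow> 'e) \<Rightarrow> bool" where
  "flat_unit L V u \<longleftrightarrow>
     (\<forall>(U, \<phi>)\<in>trivs L. \<forall>x\<in>U \<inter> V. \<exists>\<sigma>\<in>{1, -1}. \<forall>\<^sub>F y in nhds x. u y = \<phi> y \<sigma>)"

locale real_bundle =
  fixes S :: "(real ^ 3) set" and L :: "'e line_bundle"
  assumes is_bundle: "real_line_bundle S L"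
begin

lemma triv:
  assumes "(U, \<phi>) \<in> trivs L"
  shows "open U" "U \<subseteq> S" "x \<in> U \<Longrightarrow> bij_betw (\<phi> x) UNIV (fibre L x)"
  using is_bundle assms unfolding real_line_bundle_def by blast+

lemma triv_exists: assumes "x \<in> S" obtains U \<phi> where "(U, \<phi>) \<in> trivs L" "x \<in> U"
  using is_bundle assms unfolding real_line_bundle_def by blast

lemma triv_change:
  assumes "(U, \<phi>) \<in> trivs L" "(V, \<psi>) \<in> trivs L" "x \<in> U" "x \<in> V"
  shows "\<exists>s\<in>{1, -1}. \<forall>\<^sub>F y in nhds x. \<forall>t. \<psi> y t = \<phi> y (s * t)"
  using is_bundle assms unfolding real_line_bundle_def by blast

lemma triv_inj: "(U, \<phi>) \<in> trivs L \<Longrightarrow> x \<in> U \<Longrightarrow> \<phi> x t = \<phi> x t' \<longleftrightarrow> t = t'"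
  using triv(3) unfolding bij_betw_def inj_def by metis

lemma triv_inv [simp]: "(U, \<phi>) \<in> trivs L \<Longrightarrow> x \<in> U \<Longrightarrow> inv (\<phi> x) (\<phi> x t) = t"
  using triv(3) by (intro inv_f_f) (auto simp: bij_betw_def)

lemma eventually_triv: "(U, \<phi>) \<in> trivs L \<Longrightarrow> x \<in> U \<Longrightarrow> \<forall>\<^sub>F y in nhds x. y \<in> U"
  using triv(1) by (rule eventually_nhds_in_open)

lemma fibre_scale:
  assumes "(U, \<phi>) \<in> trivs L" "x \<in> U"
  shows "fibre_scale L x c (\<phi> x t) = \<phi> x (c * t)"
proof -
  define p where "p = (SOME p. p \<in> trivs L \<and> x \<in> fst p)"
  obtain V \<psi> where p: "p = (V, \<psi>)" by (cases p)
  have "\<exists>p. p \<in> trivs L \<and> x \<in> fst p" using assms by (intro exI[of _ "(U, \<phi>)"]) auto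
  then have "p \<in> trivs L \<and> x \<in> fst p" unfolding p_def by (rule someI_ex)
  then have V: "(V, \<psi>) \<in> trivs L" "x \<in> V" by (auto simp: p)
  obtain s where s: "s \<in> {1, -1}" "\<forall>\<^sub>F y in nhds x. \<forall>t. \<psi> y t = \<phi> y (s * t)"
    using triv_change[OF assms(1) V(1) assms(2) V(2)] by blast
  from eventually_nhds_x_imp_x[OF s(2)] have \<psi>: "\<psi> x t = \<phi> x (s * t)" for t by blast
  have "\<phi> x t = \<psi> x (s * t)" using s(1) by (auto simp: \<psi>)
  then have "inv (\<psi> x) (\<phi> x t) = s * t" using V by simp
  then show ?thesis using s(1) unfolding fibre_scale_def p_def[symmetric] p by (auto simp: \<psi>)
qed

lemma flat_unit_at:
  assumes "flat_unit L V u" "(U, \<phi>) \<in> trivs L" "x \<in> U" "x \<in> V"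
  obtains \<sigma> where "\<sigma> \<in> {1, -1}" "\<forall>\<^sub>F y in nhds x. y \<in> U \<and> u y = \<phi> y \<sigma>" "u x = \<phi> x \<sigma>"
proof -
  obtain \<sigma> where "\<sigma> \<in> {1, -1}" "\<forall>\<^sub>F y in nhds x. u y = \<phi> y \<sigma>"
    using assms unfolding flat_unit_def by blast
  then show ?thesis
    using that[of \<sigma>] eventually_conj[OF eventually_triv[OF assms(2,3)]]
      eventually_nhds_x_imp_x[of "\<lambda>y. u y = \<phi> y \<sigma>" x] by simp
qed

lemma flat_unit_subset: "flat_unit L V u \<Longrightarrow> W \<subseteq> V \<Longrightarrow> flat_unit L W u"
  unfolding flat_unit_def by blast

lemma flat_unit_cong:
  assumes "open V" "flat_unit L V v" "\<And>x. x \<in> V \<Longrightarrow> u x = v x"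
  shows "flat_unit L V u"
proof -
  have "\<exists>\<sigma>\<in>{1, -1}. \<forall>\<^sub>F y in nhds x. u y = \<phi> y \<sigma>"
    if U: "(U, \<phi>) \<in> trivs L" and x: "x \<in> U" "x \<in> V" for U \<phi> x
  proof -
    obtain \<sigma> where "\<sigma> \<in> {1, -1}" "\<forall>\<^sub>F y in nhds x. y \<in> U \<and> v y = \<phi> y \<sigma>"
      using flat_unit_at[OF assms(2) U x] by metis
    then show ?thesis
      using eventually_nhds_in_open[OF assms(1) x(2)] assms(3)
      by (intro bexI[of _ \<sigma>]) (auto elim: eventually_elim2)
  qed
  then show ?thesis unfolding flat_unit_def by blast
qed

lemma flat_unit_scale:
  assumes "flat_unit L V u" "\<sigma> \<in> {1, -1}"
  shows "flat_unit L V (\<lambda>x. fibre_scale L x \<sigma> (u x))"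
proof -
  have "\<exists>\<sigma>'\<in>{1, -1}. \<forall>\<^sub>F y in nhds x. fibre_scale L y \<sigma> (u y) = \<phi> y \<sigma>'"
    if U: "(U, \<phi>) \<in> trivs L" and x: "x \<in> U" "x \<in> V" for U \<phi> x
  proof -
    obtain \<tau> where \<tau>: "\<tau> \<in> {1, -1}" "\<forall>\<^sub>F y in nhds x. y \<in> U \<and> u y = \<phi> y \<tau>"
      using flat_unit_at[OF assms(1) U x] by metis
    then have "\<forall>\<^sub>F y in nhds x. fibre_scale L y \<sigma> (u y) = \<phi> y (\<sigma> * \<tau>)"
      by (auto elim!: eventually_mono simp: fibre_scale[OF U])
    then show ?thesis using \<tau>(1) assms(2) by (intro bexI[of _ "\<sigma> * \<tau>"]) auto
  qed
  then show ?thesis unfolding flat_unit_def by blast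
qed

lemma flat_unit_triv: assumes "(U, \<phi>) \<in> trivs L" shows "flat_unit L U (\<lambda>x. \<phi> x 1)"
proof -
  have "\<exists>\<sigma>\<in>{1, -1}. \<forall>\<^sub>F y in nhds x. \<phi> y 1 = \<psi> y \<sigma>" if V: "(V, \<psi>) \<in> trivs L" "x \<in> V" "x \<in> U" for V \<psi> x
  proof -
    obtain s where s: "s \<in> {1, -1}" "\<forall>\<^sub>F y in nhds x. \<forall>t. \<phi> y t = \<psi> y (s * t)"
      using triv_change[OF V(1) assms V(2,3)] by blast
    then have "\<forall>\<^sub>F y in nhds x. \<phi> y 1 = \<psi> y s" by (auto elim!: eventually_mono)
    then show ?thesis using s(1) by blast
  qed
  then show ?thesis unfolding flat_unit_def by blast
qed

text \<open>Near each point the truth value of \<open>u y = v y\<close> is constant, as it only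
  compares two fixed signs; connectedness does the rest.\<close>

lemma flat_unit_unique:
  assumes "connected V" "V \<subseteq> S" "flat_unit L V u" "flat_unit L V v" "x0 \<in> V" "u x0 = v x0" "x \<in> V"
  shows "u x = v x"
proof -
  have "\<exists>T. openin (top_of_set V) T \<and> x \<in> T \<and> (\<forall>y\<in>T. (u y = v y) = (u x = v x))" if x: "x \<in> V" for x
  proof -
    obtain U \<phi> where U: "(U, \<phi>) \<in> trivs L" "x \<in> U" using triv_exists assms(2) x by blast
    obtain \<sigma> where \<sigma>: "\<forall>\<^sub>F y in nhds x. y \<in> U \<and> u y = \<phi> y \<sigma>"
      using flat_unit_at[OF assms(3) U x] by metis
    obtain \<tau> where \<tau>: "\<forall>\<^sub>F y in nhds x. y \<in> U \<and> v y = \<phi> y \<tau>"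
      using flat_unit_at[OF assms(4) U x] by metis
    have "\<forall>\<^sub>F y in nhds x. (u y = v y) = (\<sigma> = \<tau>)"
      using \<sigma> \<tau> by eventually_elim (use triv_inj[OF U(1)] in auto)
    then obtain T where T: "open T" "x \<in> T" "\<And>y. y \<in> T \<Longrightarrow> (u y = v y) = (\<sigma> = \<tau>)"
      unfolding eventually_nhds by blast
    then show ?thesis using x by (intro exI[of _ "V \<inter> T"]) auto
  qed
  then have "(\<lambda>y. u y = v y) constant_on V" by (rule locally_constant_imp_constant[OF assms(1)])
  then show ?thesis using assms(5-7) unfolding constant_on_def by metis
qed

lemma flat_unit_sign:
  assumes "connected V" "V \<subseteq> S" "flat_unit L V u" "flat_unit L V v" "x0 \<in> V"
  obtains \<sigma> where "\<sigma> \<in> {1, -1}" "\<And>x. x \<in> V \<Longrightarrow> v x = fibre_scale L x \<sigma> (u x)"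
proof -
  obtain U \<phi> where U: "(U, \<phi>) \<in> trivs L" "x0 \<in> U" using triv_exists assms by blast
  obtain s where s: "s \<in> {1, -1}" "u x0 = \<phi> x0 s" using flat_unit_at[OF assms(3) U assms(5)] by metis
  obtain t where t: "t \<in> {1, -1}" "v x0 = \<phi> x0 t" using flat_unit_at[OF assms(4) U assms(5)] by metis
  have st: "s * t \<in> {1, -1}" using s t by auto
  have "v x0 = fibre_scale L x0 (s * t) (u x0)" using s t by (auto simp: fibre_scale[OF U])
  from flat_unit_unique[OF assms(1,2,4) flat_unit_scale[OF assms(3) st] assms(5) this] st that
  show ?thesis by blast
qed

lemma flat_unit_glue:
  assumes "open V" "open W" "flat_unit L V u" "flat_unit L W v" "\<And>x. x \<in> V \<Longrightarrow> x \<in> W \<Longrightarrow> u x = v x"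
  shows "flat_unit L (V \<union> W) (\<lambda>x. if x \<in> V then u x else v x)"
proof -
  have "flat_unit L V (\<lambda>x. if x \<in> V then u x else v x)" "flat_unit L W (\<lambda>x. if x \<in> V then u x else v x)"
    by (rule flat_unit_cong[OF assms(1,3)], simp, rule flat_unit_cong[OF assms(2,4)], simp add: assms(5))
  then show ?thesis unfolding flat_unit_def by blast
qed

text \<open>On the connected overlap the two sections differ by one sign, and rescaling
  \<open>v\<close> by it makes them agree.\<close>

lemma flat_unit_union:
  assumes "open V" "open W" "flat_unit L V u" "flat_unit L W v" "connected (V \<inter> W)" "V \<inter> W \<noteq> {}" "V \<subseteq> S"
  shows "\<exists>u'. flat_unit L (V \<union> W) u'"
proof -
  obtain x0 where x0: "x0 \<in> V \<inter> W" using assms(6) by blast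
  obtain \<sigma> where \<sigma>: "\<sigma> \<in> {1, -1}" "\<And>x. x \<in> V \<inter> W \<Longrightarrow> u x = fibre_scale L x \<sigma> (v x)"
    by (rule flat_unit_sign[of "V \<inter> W" v u x0]) (use assms x0 flat_unit_subset in auto)
  then show ?thesis
    using flat_unit_glue[OF assms(1,2,3) flat_unit_scale[OF assms(4) \<sigma>(1)]] by blast
qed

text \<open>Bisection of the parameter interval: short pieces lie in one trivialization, and
  adjacent pieces are merged. Convexity of the neighbourhoods is carried along to keep their
  overlaps connected.\<close>

lemma flat_unit_segment:
  assumes "closed_segment p q \<subseteq> S"
  shows "\<exists>V u. open V \<and> convex V \<and> closed_segment p q \<subseteq> V \<and> V \<subseteq> S \<and> flat_unit L V u"
proof -
  define \<gamma> where "\<gamma> t = p + t *\<^sub>R (q - p)" for t :: real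
  have seg: "\<gamma> ` {0..1} = closed_segment p q"
    unfolding \<gamma>_def closed_segment_image_interval by (intro image_cong) (auto simp: algebra_simps)
  have cont: "continuous_on A \<gamma>" for A unfolding \<gamma>_def by (intro continuous_intros)
  have conv: "convex (\<gamma> ` {s..t})" for s t
  proof -
    have "\<gamma> ` {s..t} = (+) p ` ((\<lambda>t. t *\<^sub>R (q - p)) ` {s..t})" by (auto simp: \<gamma>_def)
    moreover have "convex ((\<lambda>t. t *\<^sub>R (q - p)) ` {s..t})"
      by (intro convex_linear_image) (auto intro: bounded_linear.linear bounded_linear_scaleR_left)
    ultimately show ?thesis by (simp add: convex_translation)
  qed
  define P where "P s t \<longleftrightarrow> (\<exists>V u. open V \<and> convex V \<and> \<gamma> ` {s..t} \<subseteq> V \<and> V \<subseteq> S \<and> flat_unit L V u)" for s t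
  have "P 0 1"
  proof (rule Bolzano)
    fix r s t assume rst: "P r s" "P s t" "r \<le> s" "s \<le> t"
    then obtain V u W v where V: "open V" "convex V" "\<gamma> ` {r..s} \<subseteq> V" "V \<subseteq> S" "flat_unit L V u"
      and W: "open W" "convex W" "\<gamma> ` {s..t} \<subseteq> W" "W \<subseteq> S" "flat_unit L W v" unfolding P_def by blast
    have "\<gamma> s \<in> V \<inter> W" using V W rst by auto
    then obtain u' where u': "flat_unit L (V \<union> W) u'"
      using flat_unit_union[OF V(1) W(1) V(5) W(5)] V(2,4) W(2) convex_connected convex_Int by blast
    have "{r..t} = {r..s} \<union> {s..t}" using rst by auto
    then have "\<gamma> ` {r..t} \<subseteq> V \<union> W" using V W by auto
    \<comment> \<open>The union of two convex sets need not be convex, so it is shrunk to a convex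
      neighbourhood of the merged piece.\<close>
    then obtain V' where "open V'" "convex V'" "\<gamma> ` {r..t} \<subseteq> V'" "V' \<subseteq> V \<union> W"
      using convex_open_neighbourhood[OF compact_continuous_image[OF cont compact_Icc] conv] V W by (meson open_Un)
    then show "P r t" unfolding P_def using u' flat_unit_subset V W by (meson Un_least order_trans)
  next
    fix x :: real assume "0 \<le> x" "x \<le> 1"
    then have "\<gamma> x \<in> S" using seg assms by auto
    then obtain U \<phi> where U: "(U, \<phi>) \<in> trivs L" "\<gamma> x \<in> U" using triv_exists by blast
    obtain r where r: "r > 0" "ball (\<gamma> x) r \<subseteq> U" using triv(1)[OF U(1)] U(2) open_contains_ball by blast
    have "isCont \<gamma> x" unfolding \<gamma>_def by (intro continuous_intros)
    then obtain d where d: "d > 0" "\<And>t. dist t x < d \<Longrightarrow> dist (\<gamma> t) (\<gamma> x) < r"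
      using r(1) unfolding continuous_at_eps_delta by blast
    have "P a b"
      if "a \<le> x \<and> x \<le> b \<and> b - a < d" for a b
    proof -
      have "\<gamma> ` {a..b} \<subseteq> ball (\<gamma> x) r"
      proof clarsimp
        fix t assume "a \<le> t" "t \<le> b"
        then have "dist t x < d" using that by (auto simp: dist_real_def)
        then show "dist (\<gamma> x) (\<gamma> t) < r" using d(2) by (simp add: dist_commute)
      qed
      moreover have "flat_unit L (ball (\<gamma> x) r) (\<lambda>y. \<phi> y 1)"
        using flat_unit_subset[OF flat_unit_triv[OF U(1)] r(2)] .
      ultimately show ?thesis unfolding P_def using r(2) triv(2)[OF U(1)] by (meson convex_ball open_ball order_trans)
    qed
    then show "\<exists>d>0. \<forall>a b. a \<le> x \<and> x \<le> b \<and> b - a < d \<longrightarrow> P a b" using d(1) by blast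
  qed auto
  then show ?thesis by (simp add: P_def seg)
qed

text \<open>The flat section along the segment to each point is normalized at the centre
  \<open>p\<close>; its value at the end point defines the section sought.\<close>

lemma flat_unit_starlike:
  assumes "open \<Omega>" "\<Omega> \<subseteq> S" "p \<in> \<Omega>" "\<And>x. x \<in> \<Omega> \<Longrightarrow> closed_segment p x \<subseteq> \<Omega>"
  obtains u where "flat_unit L \<Omega> u"
proof -
  obtain U \<phi> where U: "(U, \<phi>) \<in> trivs L" "p \<in> U" using triv_exists assms by blast
  define good where "good x V v \<longleftrightarrow> open V \<and> convex V \<and> closed_segment p x \<subseteq> V \<and> V \<subseteq> S \<and> flat_unit L V v \<and> v p = \<phi> p 1"
    for x V v
  have "\<exists>V v. good x V v"
    if x: "x \<in> \<Omega>" for x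
  proof -
    obtain V v where V: "open V" "convex V" "closed_segment p x \<subseteq> V" "V \<subseteq> S" "flat_unit L V v"
      using flat_unit_segment[of p x] assms(2,4) x by (metis order_trans)
    have "p \<in> V" using V(3) by auto
    then obtain \<sigma> where \<sigma>: "\<sigma> \<in> {1, -1}" "v p = \<phi> p \<sigma>" using flat_unit_at[OF V(5) U] by metis
    then have "fibre_scale L p \<sigma> (v p) = \<phi> p 1" by (auto simp: fibre_scale[OF U])
    then show ?thesis unfolding good_def using V flat_unit_scale[OF V(5) \<sigma>(1)] by blast
  qed
  then obtain V v where "\<And>x. x \<in> \<Omega> \<Longrightarrow> good x (V x) (v x)" by metis
  then have V: "\<And>x. x \<in> \<Omega> \<Longrightarrow> open (V x)" "\<And>x. x \<in> \<Omega> \<Longrightarrow> convex (V x)"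
    "\<And>x. x \<in> \<Omega> \<Longrightarrow> closed_segment p x \<subseteq> V x" "\<And>x. x \<in> \<Omega> \<Longrightarrow> V x \<subseteq> S"
    "\<And>x. x \<in> \<Omega> \<Longrightarrow> flat_unit L (V x) (v x)" "\<And>x. x \<in> \<Omega> \<Longrightarrow> v x p = \<phi> p 1"
    unfolding good_def by blast+
  have "flat_unit L (\<Omega> \<inter> V x) (\<lambda>y. v y y)" if x: "x \<in> \<Omega>" for x
  proof (rule flat_unit_cong)
    show "open (\<Omega> \<inter> V x)" using assms(1) V(1) x by blast
    show "flat_unit L (\<Omega> \<inter> V x) (v x)" using flat_unit_subset[OF V(5)[OF x]] by blast
    \<comment> \<open>Both sections live on the convex set \<open>V x \<inter> V y\<close>, which
      contains \<open>p\<close>, where they have the same value.\<close>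
    show "v y y = v x y" if y: "y \<in> \<Omega> \<inter> V x" for y
    proof (rule flat_unit_unique[where u = "v y" and v = "v x" and V = "V x \<inter> V y"])
      show "connected (V x \<inter> V y)" using V(2) x y convex_connected convex_Int by blast
      show "V x \<inter> V y \<subseteq> S" using V(4) x by blast
      show "flat_unit L (V x \<inter> V y) (v y)" "flat_unit L (V x \<inter> V y) (v x)"
        using V(5) x y flat_unit_subset by (blast, blast)
      show "v y p = v x p" using V(6) x y by simp
      show "p \<in> V x \<inter> V y" "y \<in> V x \<inter> V y"
        using V(3)[OF x] V(3)[of y] y by (auto simp: subset_iff)
    qed
  qed
  then have "flat_unit L (\<Union>x\<in>\<Omega>. \<Omega> \<inter> V x) (\<lambda>y. v y y)" unfolding flat_unit_def by blast
  moreover have "(\<Union>x\<in>\<Omega>. \<Omega> \<inter> V x) = \<Omega>" using V(3) by fastforce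
  ultimately show ?thesis using that by simp
qed

end

section \<open>Sections of the twisted bundle\<close>

lemma complex_dist_sq_eq_0_iff: "complex_dist_sq a n x = 0 \<longleftrightarrow> x \<in> unit_circle a n"
proof -
  have "dist a x = norm (x - a)" by (simp add: dist_norm norm_minus_commute)
  then show ?thesis
    by (simp add: complex_dist_sq_def unit_circle_def complex_eq_iff norm_eq_1)
qed

lemma closed_unit_circle: "closed (unit_circle a n)"
proof -
  have "unit_circle a n = {x. dist a x = 1} \<inter> {x. (x - a) \<bullet> n = 0}" by (auto simp: unit_circle_def)
  then show ?thesis by (simp only:) (intro closed_Int closed_Collect_eq continuous_intros)
qed

text \<open>The origin of the sign change: the two branches agree above the real axis and are
  opposite below it.\<close>

lemma csqrt_branches:
  shows "Im z > 0 \<Longrightarrow> csqrt z = \<i> * csqrt (- z)" "Im z < 0 \<Longrightarrow> csqrt z = - (\<i> * csqrt (- z))"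
proof -
  assume "Im z > 0"
  then have "csqrt (- (- z)) = \<i> * csqrt (- z)" by (intro csqrt_minus) simp
  then show "csqrt z = \<i> * csqrt (- z)" by (simp only: minus_minus)
next
  assume "Im z < 0"
  then have "csqrt (- z) = \<i> * csqrt z" by (intro csqrt_minus) simp
  then show "csqrt z = - (\<i> * csqrt (- z))" by (simp only: mult.assoc[symmetric] i_squared) simp
qed

context real_bundle
begin

lemma triv_in_fibre: "(U, \<phi>) \<in> trivs L \<Longrightarrow> x \<in> U \<Longrightarrow> \<phi> x t \<in> fibre L x"
  using bij_betw_apply[OF triv(3)] by blast

lemma flat_unit_fibre:
  assumes "flat_unit L V u" "x \<in> V" "x \<in> S" shows "u x \<in> fibre L x"
proof -
  obtain U \<phi> where U: "(U, \<phi>) \<in> trivs L" "x \<in> U" using triv_exists assms(3) by blast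
  obtain \<sigma> where "u x = \<phi> x \<sigma>" using flat_unit_at[OF assms(1) U assms(2)] by metis
  then show ?thesis using triv_in_fibre[OF U] by simp
qed

lemma fibre_scale_in_fibre:
  assumes "x \<in> S" "e \<in> fibre L x"
  shows "fibre_scale L x c e \<in> fibre L x" "fibre_scale L x 1 e = e"
    "fibre_scale L x c (fibre_scale L x d e) = fibre_scale L x (c * d) e"
proof -
  obtain U \<phi> where U: "(U, \<phi>) \<in> trivs L" "x \<in> U" using triv_exists assms(1) by blast
  obtain t where "e = \<phi> x t"
    using bij_betw_imp_surj_on[OF triv(3)[OF U]] assms(2) by (metis imageE)
  then show "fibre_scale L x c e \<in> fibre L x" "fibre_scale L x 1 e = e"
    "fibre_scale L x c (fibre_scale L x d e) = fibre_scale L x (c * d) e"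
    using triv_in_fibre[OF U] by (simp_all add: fibre_scale[OF U] mult.assoc)
qed

lemma flat_lift_comp:
  assumes "flat_unit L V u" "V \<subseteq> S" "continuous_on UNIV \<gamma>" "\<And>t. \<gamma> t \<in> V"
  shows "flat_lift L \<gamma> (\<lambda>t. u (\<gamma> t))"
proof -
  have "\<exists>c. \<exists>\<epsilon>>0. \<forall>\<tau>\<in>{0..1}. \<bar>\<tau> - t\<bar> < \<epsilon> \<longrightarrow> u (\<gamma> \<tau>) = \<phi> (\<gamma> \<tau>) c"
    if U: "(U, \<phi>) \<in> trivs L" "\<gamma> t \<in> U" for U \<phi> t
  proof -
    obtain \<sigma> where \<sigma>: "\<forall>\<^sub>F y in nhds (\<gamma> t). y \<in> U \<and> u y = \<phi> y \<sigma>"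
      using flat_unit_at[OF assms(1) U assms(4)] by metis
    have "(\<gamma> \<longlongrightarrow> \<gamma> t) (nhds t)"
      using assms(3) by (simp add: continuous_on_eq_continuous_at tendsto_nhds_iff isCont_def)
    from eventually_compose_filterlim[OF \<sigma> this]
    have "\<forall>\<^sub>F \<tau> in nhds t. u (\<gamma> \<tau>) = \<phi> (\<gamma> \<tau>) \<sigma>" by (rule eventually_mono) simp
    then show ?thesis unfolding eventually_nhds_metric dist_real_def by blast
  qed
  then show ?thesis
    using flat_unit_fibre[OF assms(1)] assms(2,4) unfolding flat_lift_def by blast
qed

text \<open>Along the loop the section is a flat lift that returns to its initial value, whose
  coordinate is nonzero; the factor -1 is impossible.\<close>

lemma monodromy_flat_unit:
  assumes "flat_unit L V u" "V \<subseteq> S" "continuous_on UNIV \<gamma>" "\<And>t. \<gamma> t \<in> V" "\<gamma> 1 = \<gamma> 0"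
  shows "\<not> monodromy L \<gamma> (- 1)"
proof
  assume m: "monodromy L \<gamma> (- 1)"
  obtain U \<phi> where U: "(U, \<phi>) \<in> trivs L" "\<gamma> 0 \<in> U"
    using triv_exists[of "\<gamma> 0"] assms(2) assms(4)[of 0] by blast
  obtain \<sigma> where \<sigma>: "\<sigma> \<in> {1, -1}" "u (\<gamma> 0) = \<phi> (\<gamma> 0) \<sigma>" using flat_unit_at[OF assms(1) U assms(4)] by metis
  have "inv (\<phi> (\<gamma> 0)) (u (\<gamma> 1)) = -1 * inv (\<phi> (\<gamma> 0)) (u (\<gamma> 0))"
    using m flat_lift_comp[OF assms(1-4)] U unfolding monodromy_def by blast
  then show False using \<sigma> U assms(5) by auto
qed

text \<open>The coordinate is \<sigma> F(w) with a local sign \<sigma>. As \<open>F\<close> is odd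
  this equals F(\<sigma> w), and \<sigma> w is again a branch, so signs need not be tracked any
  further.\<close>

lemma local_rep_fibre_scale:
  assumes "root_branch a n M w" "flat_unit L M u" "\<And>y. y \<in> M \<Longrightarrow> f y = fibre_scale L y (F (w y)) (u y)"
    and U: "(U, \<phi>) \<in> trivs L" and x: "x \<in> U" "x \<in> M" and odd: "\<And>z. F (- z) = - F z"
  shows "\<exists>N w. x \<in> N \<and> N \<subseteq> U \<and> root_branch a n N w \<and> (\<forall>y\<in>N. local_rep \<phi> f y = F (w y))"
proof -
  obtain \<sigma> where \<sigma>: "\<sigma> \<in> {1, -1}" "\<forall>\<^sub>F y in nhds x. y \<in> U \<and> u y = \<phi> y \<sigma>" "u x = \<phi> x \<sigma>"
    by (rule flat_unit_at[OF assms(2) U x])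
  have M: "open M" using assms(1) by (simp add: root_branch_def)
  have "\<forall>\<^sub>F y in nhds x. y \<in> M \<and> y \<in> U \<and> u y = \<phi> y \<sigma>"
    using eventually_conj[OF eventually_nhds_in_open[OF M x(2)] \<sigma>(2)] .
  then obtain N where N: "open N" "x \<in> N" "\<And>y. y \<in> N \<Longrightarrow> y \<in> M \<and> y \<in> U \<and> u y = \<phi> y \<sigma>"
    unfolding eventually_nhds by blast
  have rep: "local_rep \<phi> f y = F (w y) * \<sigma>" if "y \<in> N" for y
    using N(3)[OF that] U assms(3)[of y] by (simp add: local_rep_def fibre_scale[OF U])
  have w: "root_branch a n N w" using root_branch_subset[OF assms(1) N(1)] N(3) by blast
  have NU: "N \<subseteq> U" using N(3) by blast
  from \<sigma>(1) consider "\<sigma> = 1" | "\<sigma> = -1" by blast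
  then show ?thesis
  proof cases
    case 1
    then show ?thesis using N(2) NU w rep by (intro exI[of _ N] exI[of _ w]) simp
  next
    case 2
    then show ?thesis
      using N(2) NU root_branch_uminus[OF w] rep odd
      by (intro exI[of _ N] exI[of _ "\<lambda>x. - w x"]) simp
  qed
qed

end

section \<open>The slit complement and the half-spaces that cross the slit\<close>

locale twisted_bundle = real_bundle "- unit_circle a n" L for a n :: "real ^ 3" and L :: "'e line_bundle" +
  assumes norm_n: "norm n = 1" and twisted: "twisted_around_circle a n L"
begin

definition "cut_space = {x. (x - a) \<bullet> n \<noteq> 0 \<or> norm (x - a) < 1}"

text \<open>For a unit vector \<open>c\<close> orthogonal to \<open>n\<close>, this is the region
  beyond the tangent plane of the unit sphere at a + c. It is convex, avoids the circle, and there
  the squared complex distance has positive real part, so the principal root is available. Each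
  point of the slit off the circle lies in the one of its own radial direction.\<close>

definition "half_space c = {x. (x - a) \<bullet> c > 1}"

lemma open_cut_space: "open cut_space"
  unfolding cut_space_def Collect_disj_eq
  by (intro open_Un open_Collect_neq open_Collect_less continuous_intros)

lemma open_half_space: "open (half_space c)"
  unfolding half_space_def by (intro open_Collect_less continuous_intros)

lemma convex_half_space: "convex (half_space c)"
proof -
  have "half_space c = {x. c \<bullet> x > 1 + a \<bullet> c}" by (auto simp: half_space_def inner_diff_left inner_commute[of c])
  then show ?thesis by (simp add: convex_halfspace_gt)
qed

lemma convex_upper: "convex {x. (x - a) \<bullet> n > 0}" "convex {x. (x - a) \<bullet> n < 0}"
proof -
  have "{x. (x - a) \<bullet> n > 0} = {x. n \<bullet> x > a \<bullet> n}" "{x. (x - a) \<bullet> n < 0} = {x. n \<bullet> x < a \<bullet> n}"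
    by (auto simp: inner_diff_left inner_commute[of n])
  then show "convex {x. (x - a) \<bullet> n > 0}" "convex {x. (x - a) \<bullet> n < 0}"
    by (simp_all add: convex_halfspace_gt convex_halfspace_lt)
qed

lemma cut_space_dist: assumes "x \<in> cut_space" shows "- complex_dist_sq a n x \<notin> \<real>\<^sub>\<le>\<^sub>0"
proof (cases "(x - a) \<bullet> n = 0")
  case True
  then have "(norm (x - a))\<^sup>2 < 1\<^sup>2"
    using assms by (intro power_strict_mono) (auto simp: cut_space_def)
  then show ?thesis by (simp add: complex_nonpos_Reals_iff complex_dist_sq_def dot_square_norm)
qed (simp add: complex_nonpos_Reals_iff complex_dist_sq_def)

lemma half_space_norm: assumes "x \<in> half_space c" "norm c = 1" shows "norm (x - a) > 1"
  using assms norm_cauchy_schwarz[of "x - a" c] by (simp add: half_space_def)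

lemma half_space_dist: assumes "x \<in> half_space c" "norm c = 1" shows "complex_dist_sq a n x \<notin> \<real>\<^sub>\<le>\<^sub>0"
proof -
  have "1 < (norm (x - a))\<^sup>2" using half_space_norm[OF assms] by (rule one_less_power) simp
  then show ?thesis by (simp add: complex_nonpos_Reals_iff complex_dist_sq_def dot_square_norm)
qed

lemma not_in_unit_circle: "complex_dist_sq a n x \<noteq> 0 \<Longrightarrow> x \<in> - unit_circle a n"
  by (simp add: complex_dist_sq_eq_0_iff)

lemma cut_space_subset: "cut_space \<subseteq> - unit_circle a n"
proof
  fix x assume "x \<in> cut_space"
  from cut_space_dist[OF this] show "x \<in> - unit_circle a n" by (intro not_in_unit_circle) auto
qed

lemma half_space_subset: assumes "norm c = 1" shows "half_space c \<subseteq> - unit_circle a n"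
proof
  fix x assume "x \<in> half_space c"
  from half_space_dist[OF this assms] show "x \<in> - unit_circle a n" by (intro not_in_unit_circle) auto
qed

lemma half_space_in_cut_space:
  assumes "x \<in> half_space c" "norm c = 1" "x \<in> cut_space"
  shows "(x - a) \<bullet> n > 0 \<or> (x - a) \<bullet> n < 0"
  using half_space_norm[OF assms(1,2)] assms(3) unfolding cut_space_def mem_Collect_eq by linarith

lemma exists_flat_unit_cut_space: obtains u where "flat_unit L cut_space u"
proof (rule flat_unit_starlike[OF open_cut_space cut_space_subset])
  show "a \<in> cut_space" by (simp add: cut_space_def)
  show "closed_segment a x \<subseteq> cut_space" if x: "x \<in> cut_space" for x
  proof
    fix y assume "y \<in> closed_segment a x"
    then obtain t where t: "0 \<le> t" "t \<le> 1" "y = (1 - t) *\<^sub>R a + t *\<^sub>R x" by (auto simp: closed_segment_def)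
    have y: "y - a = t *\<^sub>R (x - a)" using t(3) by (simp add: algebra_simps)
    show "y \<in> cut_space"
    proof (cases "t = 0 \<or> (x - a) \<bullet> n \<noteq> 0")
      case True then show ?thesis by (auto simp: cut_space_def y)
    next
      case False
      then have "norm (x - a) < 1" using x by (simp add: cut_space_def)
      then have "t * norm (x - a) < 1" using t False mult_left_le_one_le[of "norm (x - a)" t] by simp
      then show ?thesis using t(1) unfolding cut_space_def mem_Collect_eq y by simp
    qed
  qed
qed

lemma exists_flat_unit_half_space:
  assumes "norm c = 1" obtains v where "flat_unit L (half_space c) v"
proof (rule flat_unit_starlike[OF open_half_space half_space_subset[OF assms]])
  show p: "a + 2 *\<^sub>R c \<in> half_space c" using assms by (simp add: half_space_def dot_square_norm)
  show "closed_segment (a + 2 *\<^sub>R c) x \<subseteq> half_space c" if "x \<in> half_space c" for x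
    using convex_half_space p that by (simp add: closed_segment_subset)
qed

text \<open>A section that continues \<open>u\<close> across the exterior of the disc would be flat along a meridian.\<close>

lemma no_flat_unit_continuation:
  assumes "norm c = 1" "c \<bullet> n = 0" "flat_unit L cut_space u" "flat_unit L (half_space c) v"
    and "\<And>x. x \<in> half_space c \<Longrightarrow> x \<in> cut_space \<Longrightarrow> v x = u x"
  shows False
proof -
  \<comment> \<open>This meridian meets the plane of the circle at radius 3/2, inside
    \<open>half_space c\<close>, and at radius 1/2, inside the disc; elsewhere it is off the plane,
    hence in \<open>cut_space\<close>.\<close>
  let ?\<gamma> = "meridian a n (a + c) (1 / 2)"
  have \<gamma>: "?\<gamma> t - a = (1 + cos (2 * pi * t) / 2) *\<^sub>R c + (sin (2 * pi * t) / 2) *\<^sub>R n" for t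
    by (simp add: meridian_def algebra_simps)
  have mem: "?\<gamma> t \<in> cut_space \<union> half_space c" for t
  proof (cases "cos (2 * pi * t) > 0")
    case True
    then show ?thesis
      using assms(1,2) by (simp add: half_space_def \<gamma> inner_add_left inner_commute[of n c] dot_square_norm)
  next
    case False
    show ?thesis
    proof (cases "sin (2 * pi * t) = 0")
      case True
      then have "cos (2 * pi * t) = -1" using False sin_zero_abs_cos_one[of "2 * pi * t"] by linarith
      then show ?thesis using assms(1) True by (simp add: cut_space_def \<gamma>)
    next
      case sin: False
      have "(?\<gamma> t - a) \<bullet> n = sin (2 * pi * t) / 2"
        unfolding \<gamma> using assms(2) norm_n by (simp add: inner_add_left dot_square_norm)
      then show ?thesis using sin by (simp add: cut_space_def)
    qed
  qed
  have "\<not> monodromy L ?\<gamma> (- 1)"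
  proof (rule monodromy_flat_unit)
    show "flat_unit L (cut_space \<union> half_space c) (\<lambda>x. if x \<in> cut_space then u x else v x)"
      using assms by (intro flat_unit_glue open_cut_space open_half_space) auto
    show "cut_space \<union> half_space c \<subseteq> - unit_circle a n" using cut_space_subset half_space_subset[OF assms(1)] by blast
    show "continuous_on UNIV ?\<gamma>" unfolding meridian_def by (intro continuous_intros)
    show "?\<gamma> t \<in> cut_space \<union> half_space c" for t by (rule mem)
    show "?\<gamma> 1 = ?\<gamma> 0" by (simp add: meridian_def)
  qed
  moreover have "a + c \<in> unit_circle a n" using assms(1,2) by (simp add: unit_circle_def dist_norm)
  ultimately show False using twisted unfolding twisted_around_circle_def by force
qed

text \<open>The plane divides the half-space into two convex pieces, each with its own sign relative
  to \<open>u\<close>. Normalizing the upper sign to 1 forces the lower one to be -1, for otherwise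
  \<open>u\<close> would continue across the slit.\<close>

lemma exists_twisted_continuation:
  assumes c: "norm c = 1" "c \<bullet> n = 0" and u: "flat_unit L cut_space u"
  shows "\<exists>v. flat_unit L (half_space c) v \<and>
     (\<forall>x\<in>half_space c. (x - a) \<bullet> n > 0 \<longrightarrow> v x = u x) \<and>
     (\<forall>x\<in>half_space c. (x - a) \<bullet> n < 0 \<longrightarrow> v x = fibre_scale L x (-1) (u x))"
proof -
  define P where "P = half_space c \<inter> {x. (x - a) \<bullet> n > 0}"
  define M where "M = half_space c \<inter> {x. (x - a) \<bullet> n < 0}"
  obtain v0 where v0: "flat_unit L (half_space c) v0" using exists_flat_unit_half_space[OF c(1)] .
  have conn: "connected P" "connected M"
    unfolding P_def M_def by (intro convex_connected convex_Int convex_half_space convex_upper)+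
  have sub: "P \<subseteq> - unit_circle a n" "M \<subseteq> - unit_circle a n"
    using half_space_subset[OF c(1)] by (auto simp: P_def M_def)
  have flat_u: "flat_unit L P u" "flat_unit L M u"
    by (rule flat_unit_subset[OF u], force simp: P_def M_def cut_space_def)+
  have pts: "a + 2 *\<^sub>R c + n \<in> P" "a + 2 *\<^sub>R c - n \<in> M"
    using c norm_n by (auto simp: P_def M_def half_space_def inner_add_left inner_diff_left inner_commute[of n c] dot_square_norm)
  obtain \<sigma> where \<sigma>: "\<sigma> \<in> {1, -1}" "\<And>x. x \<in> P \<Longrightarrow> u x = fibre_scale L x \<sigma> (v0 x)"
    using flat_unit_sign[OF conn(1) sub(1) flat_unit_subset[OF v0] flat_u(1) pts(1)] unfolding P_def by blast
  define v where "v x = fibre_scale L x \<sigma> (v0 x)" for x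
  have v: "flat_unit L (half_space c) v" unfolding v_def by (rule flat_unit_scale[OF v0 \<sigma>(1)])
  obtain \<tau> where \<tau>: "\<tau> \<in> {1, -1}" "\<And>x. x \<in> M \<Longrightarrow> v x = fibre_scale L x \<tau> (u x)"
    using flat_unit_sign[OF conn(2) sub(2) flat_u(2) flat_unit_subset[OF v] pts(2)] unfolding M_def by blast
  have "\<tau> \<noteq> 1"
  proof
    assume "\<tau> = 1"
    have "v x = u x" if x: "x \<in> half_space c" "x \<in> cut_space" for x
      using half_space_in_cut_space[OF x(1) c(1) x(2)]
    proof
      assume "(x - a) \<bullet> n > 0" then show ?thesis using \<sigma>(2)[of x] x by (simp add: v_def P_def)
    next
      assume "(x - a) \<bullet> n < 0"
      then have "v x = fibre_scale L x 1 (u x)" using \<tau>(2)[of x] x \<open>\<tau> = 1\<close> by (simp add: M_def)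
      then show ?thesis using fibre_scale_in_fibre(2) flat_unit_fibre[OF u x(2)] cut_space_subset x(2) by auto
    qed
    then show False using no_flat_unit_continuation[OF c u v] by blast
  qed
  then have "\<tau> = -1" using \<tau>(1) by auto
  then show ?thesis using v \<sigma>(2) \<tau>(2) by (intro exI[of _ v]) (auto simp: v_def P_def M_def)
qed

text \<open>Below the plane both the root and the flat section change sign between the two
  descriptions, so by oddness F(w1) v = F(w2) u wherever they overlap.\<close>

lemma exists_section:
  fixes F :: "complex \<Rightarrow> real"
  assumes odd: "\<And>z. F (- z) = - F z"
  shows "\<exists>f. is_section (- unit_circle a n) L f \<and>
     (\<forall>(U, \<phi>)\<in>trivs L. \<forall>x\<in>U. \<exists>N w. x \<in> N \<and> N \<subseteq> U \<and> root_branch a n N w \<and>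
        (\<forall>y\<in>N. local_rep \<phi> f y = F (w y)))"
proof -
  define w1 where "w1 = (\<lambda>x. csqrt (complex_dist_sq a n x))"
  define w2 where "w2 = (\<lambda>x. \<i> * csqrt (- complex_dist_sq a n x))"
  have w12: "(x - a) \<bullet> n > 0 \<Longrightarrow> w1 x = w2 x" "(x - a) \<bullet> n < 0 \<Longrightarrow> w1 x = - w2 x" for x
    unfolding w1_def w2_def by (rule csqrt_branches, simp add: complex_dist_sq_def)+
  obtain u where u: "flat_unit L cut_space u" using exists_flat_unit_cut_space .
  define dir where "dir c \<longleftrightarrow> norm c = 1 \<and> c \<bullet> n = 0" for c
  have "\<exists>v. flat_unit L (half_space c) v \<and>
     (\<forall>x\<in>half_space c. (x - a) \<bullet> n > 0 \<longrightarrow> v x = u x) \<and>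
     (\<forall>x\<in>half_space c. (x - a) \<bullet> n < 0 \<longrightarrow> v x = fibre_scale L x (-1) (u x))" if "dir c" for c
    using exists_twisted_continuation u that unfolding dir_def by blast
  then obtain v where v: "\<And>c. dir c \<Longrightarrow> flat_unit L (half_space c) (v c)"
     "\<And>c x. dir c \<Longrightarrow> x \<in> half_space c \<Longrightarrow> (x - a) \<bullet> n > 0 \<Longrightarrow> v c x = u x"
     "\<And>c x. dir c \<Longrightarrow> x \<in> half_space c \<Longrightarrow> (x - a) \<bullet> n < 0 \<Longrightarrow> v c x = fibre_scale L x (-1) (u x)"
    by metis
  define radial where "radial x = (1 / norm (x - a)) *\<^sub>R (x - a)" for x
  have radial: "dir (radial x)" "x \<in> half_space (radial x)" if x: "x \<notin> cut_space" "x \<notin> unit_circle a n" for x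
  proof -
    have "(x - a) \<bullet> n = 0" "norm (x - a) > 1"
      using x by (auto simp: cut_space_def unit_circle_def dist_norm norm_minus_commute)
    then show "dir (radial x)" "x \<in> half_space (radial x)"
      by (auto simp: dir_def radial_def half_space_def dot_square_norm power2_eq_square)
  qed
  define f where "f x = (if x \<in> cut_space then fibre_scale L x (F (w2 x)) (u x)
     else fibre_scale L x (F (w1 x)) (v (radial x) x))" for x
  \<comment> \<open>The definition of \<open>f\<close> on the slit uses a different half-space at
    each point; one fixed half-space must give the same values for \<open>f\<close> to be smooth
    across the slit.\<close>
  have f_half: "f x = fibre_scale L x (F (w1 x)) (v c x)" if c: "dir c" and x: "x \<in> half_space c" for c x
  proof -
    have c1: "norm c = 1" using c by (simp add: dir_def)
    have xS: "x \<in> - unit_circle a n" using half_space_subset[OF c1] x by blast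
    show ?thesis
    proof (cases "x \<in> cut_space")
      case True
      note ux = flat_unit_fibre[OF u True xS]
      from half_space_in_cut_space[OF x c1 True] show ?thesis
      proof
        assume "(x - a) \<bullet> n > 0" then show ?thesis using v(2)[OF c x] w12 True by (simp add: f_def)
      next
        assume "(x - a) \<bullet> n < 0"
        then show ?thesis using v(3)[OF c x] w12 True by (simp add: f_def odd fibre_scale_in_fibre(3)[OF xS ux])
      qed
    next
      case False
      note r = radial[OF False] xS
      have "v (radial x) x = v c x"
      \<comment> \<open>The comparison point \<open>x + n\<close> is above the plane, where both
        continuations equal \<open>u\<close>; it stays in both half-spaces because their directions
        are orthogonal to \<open>n\<close>.\<close>
      proof (rule flat_unit_unique[where u = "v (radial x)" and v = "v c"
              and V = "half_space (radial x) \<inter> half_space c"])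
        show "connected (half_space (radial x) \<inter> half_space c)"
          by (intro convex_connected convex_Int convex_half_space)
        show "flat_unit L (half_space (radial x) \<inter> half_space c) (v (radial x))"
          "flat_unit L (half_space (radial x) \<inter> half_space c) (v c)"
          using v(1) r c flat_unit_subset by (meson ComplD inf_le1, meson inf_le2)
        have shift: "x + n \<in> half_space d" if "dir d" "x \<in> half_space d" for d
          using that by (simp add: dir_def half_space_def inner_diff_left inner_add_left inner_commute[of n d])
        show xn: "x + n \<in> half_space (radial x) \<inter> half_space c" using shift r c x by auto
        have "(x - a) \<bullet> n = 0" using False by (simp add: cut_space_def)
        then have "(x + n - a) \<bullet> n > 0" using norm_n by (simp add: inner_diff_left inner_add_left dot_square_norm)
        then show "v (radial x) (x + n) = v c (x + n)" using v(2) r c xn by auto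
        show "half_space (radial x) \<inter> half_space c \<subseteq> - unit_circle a n" using half_space_subset[OF c1] by blast
      qed (use r x in auto)
      then show ?thesis using False by (simp add: f_def)
    qed
  qed
  have sec: "is_section (- unit_circle a n) L f"
    unfolding is_section_def
  proof
    fix x assume x: "x \<in> - unit_circle a n"
    show "f x \<in> fibre L x"
    proof (cases "x \<in> cut_space")
      case True then show ?thesis using fibre_scale_in_fibre(1)[OF x flat_unit_fibre[OF u True x]] by (simp add: f_def)
    next
      case False
      then have "v (radial x) x \<in> fibre L x" using flat_unit_fibre[OF v(1)] radial x by auto
      then show ?thesis using False fibre_scale_in_fibre(1)[OF x] by (simp add: f_def)
    qed
  qed
  have rep: "\<exists>N w. x \<in> N \<and> N \<subseteq> U \<and> root_branch a n N w \<and> (\<forall>y\<in>N. local_rep \<phi> f y = F (w y))"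
    if U: "(U, \<phi>) \<in> trivs L" "x \<in> U" for U \<phi> x
  proof (cases "x \<in> cut_space")
    case True
    have "root_branch a n cut_space w2"
      unfolding w2_def by (rule root_branch_csqrt_minus[OF open_cut_space cut_space_dist])
    then show ?thesis
      by (rule local_rep_fibre_scale[where F = F, OF _ u _ U True odd]) (simp add: f_def)
  next
    case False
    have "x \<notin> unit_circle a n" using triv(2)[OF U(1)] U(2) by auto
    note r = radial[OF False this]
    have "root_branch a n (half_space (radial x)) w1"
      unfolding w1_def using r(1) by (intro root_branch_csqrt open_half_space half_space_dist) (auto simp: dir_def)
    then show ?thesis
      by (rule local_rep_fibre_scale[where F = F, OF _ v(1)[OF r(1)] _ U r(2) odd]) (rule f_half[OF r(1)])
  qed
  have "\<forall>(U, \<phi>)\<in>trivs L. \<forall>x\<in>U. \<exists>N w. x \<in> N \<and> N \<subseteq> U \<and> root_branch a n N w \<and>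
      (\<forall>y\<in>N. local_rep \<phi> f y = F (w y))"
    using rep by (intro ballI, unfold split_paired_all) simp
  with sec show ?thesis by (intro exI[of _ f] conjI)
qed

end

section \<open>Absolute value and gradient norm do not depend on the trivialization\<close>

lemma gradient_scale:
  assumes "h differentiable (at x)" "\<forall>\<^sub>F y in nhds x. g y = s * h y"
  shows "gradient g x = s *\<^sub>R gradient h x"
proof -
  have h: "(h has_derivative frechet_derivative h (at x)) (at x)" using assms(1) by (simp add: frechet_derivative_works)
  have "\<forall>\<^sub>F y in at x. s * h y = g y" "s * h x = g x"
    using assms(2) eventually_nhds_x_imp_x[OF assms(2)] by (auto simp: eventually_at_filter elim: eventually_mono)
  then have "(g has_derivative (\<lambda>v. s * frechet_derivative h (at x) v)) (at x)"
    using has_derivative_transform_eventually[OF has_derivative_mult_right[OF h]] by blast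
  then have "frechet_derivative g (at x) = (\<lambda>v. s * frechet_derivative h (at x) v)"
    using frechet_derivative_at by metis
  then show ?thesis by (simp add: gradient_def partial_def scaleR_sum_right)
qed

context real_bundle
begin

lemma local_rep_change:
  assumes "is_section S L f" and U: "(U, \<phi>) \<in> trivs L" "x \<in> U" and V: "(V, \<psi>) \<in> trivs L" "x \<in> V"
  shows "\<exists>s\<in>{1, -1}. \<forall>\<^sub>F y in nhds x. local_rep \<phi> f y = s * local_rep \<psi> f y"
proof -
  obtain s where s: "s \<in> {1, -1}" "\<forall>\<^sub>F y in nhds x. \<forall>t. \<psi> y t = \<phi> y (s * t)"
    using triv_change[OF U(1) V(1) U(2) V(2)] by blast
  have "\<forall>\<^sub>F y in nhds x. local_rep \<phi> f y = s * local_rep \<psi> f y"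
    using s(2) eventually_triv[OF U] eventually_triv[OF V]
  proof eventually_elim
    case (elim y)
    then have "f y \<in> fibre L y" using assms(1) triv(2)[OF U(1)] by (auto simp: is_section_def)
    then obtain t where "f y = \<psi> y t"
      using bij_betw_imp_surj_on[OF triv(3)[OF V(1) elim(3)]] by (metis imageE)
    moreover have "f y = \<phi> y (s * t)" using elim(1) calculation by simp
    ultimately show ?case using triv_inv[OF U(1) elim(2)] triv_inv[OF V(1) elim(3)]
      unfolding local_rep_def by metis
  qed
  then show ?thesis using s(1) by blast
qed

lemma abs_sec_eq:
  assumes "is_section S L f" "(U, \<phi>) \<in> trivs L" "x \<in> U"
  shows "abs_sec L f x = \<bar>local_rep \<phi> f x\<bar>"
  unfolding abs_sec_def
proof (rule the_equality)
  show "\<exists>(U, \<phi>')\<in>trivs L. x \<in> U \<and> \<bar>local_rep \<phi> f x\<bar> = \<bar>local_rep \<phi>' f x\<bar>" using assms by blast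
next
  fix r assume "\<exists>(U, \<phi>)\<in>trivs L. x \<in> U \<and> r = \<bar>local_rep \<phi> f x\<bar>"
  then obtain V \<psi> where V: "(V, \<psi>) \<in> trivs L" "x \<in> V" "r = \<bar>local_rep \<psi> f x\<bar>" by blast
  obtain s where "s \<in> {1, -1}" "\<forall>\<^sub>F y in nhds x. local_rep \<phi> f y = s * local_rep \<psi> f y"
    using local_rep_change[OF assms V(1,2)] by blast
  then show "r = \<bar>local_rep \<phi> f x\<bar>" using eventually_nhds_x_imp_x V(3) by (fastforce simp: abs_mult)
qed

lemma norm_grad_sec_eq:
  assumes "is_section S L f" "(U, \<phi>) \<in> trivs L" "x \<in> U" "local_rep \<phi> f differentiable (at x)"
  shows "norm_grad_sec L f x = norm (gradient (local_rep \<phi> f) x)"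
  unfolding norm_grad_sec_def
proof (rule the_equality)
  show "\<exists>(U, \<phi>')\<in>trivs L. x \<in> U \<and> norm (gradient (local_rep \<phi> f) x) = norm (gradient (local_rep \<phi>' f) x)"
    using assms by blast
next
  fix r assume "\<exists>(U, \<phi>)\<in>trivs L. x \<in> U \<and> r = norm (gradient (local_rep \<phi> f) x)"
  then obtain V \<psi> where V: "(V, \<psi>) \<in> trivs L" "x \<in> V" "r = norm (gradient (local_rep \<psi> f) x)" by blast
  obtain s where s: "s \<in> {1, -1}" "\<forall>\<^sub>F y in nhds x. local_rep \<psi> f y = s * local_rep \<phi> f y"
    using local_rep_change[OF assms(1) V(1,2) assms(2,3)] by blast
  then show "r = norm (gradient (local_rep \<phi> f) x)"
    using V(3) gradient_scale[OF assms(4) s(2)] by auto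
qed

end

section \<open>Size of the root and the main result\<close>

lemma norm_complex_dist_sq_le:
  assumes "norm n = 1" shows "norm (complex_dist_sq a n x) \<le> (norm (x - a) + 1)\<^sup>2"
proof -
  have "\<bar>(x - a) \<bullet> (x - a) - 1\<bar> \<le> (norm (x - a))\<^sup>2 + 1"
    unfolding dot_square_norm using zero_le_power2[of "norm (x - a)"] by linarith
  moreover have "\<bar>(x - a) \<bullet> n\<bar> \<le> norm (x - a)" using Cauchy_Schwarz_ineq2[of "x - a" n] assms by simp
  ultimately show ?thesis
    using cmod_le[of "complex_dist_sq a n x"] by (simp add: complex_dist_sq_def power2_eq_square algebra_simps)
qed

text \<open>The real part is (x - c) \<bullet> ((x - a) + (c - a)), at most 3 times the distance
  since the second vector has length at most 1 + 2; the imaginary part adds 2.\<close>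

lemma norm_complex_dist_sq_le_dist:
  assumes "norm n = 1" "c \<in> unit_circle a n" "dist x c \<le> 1"
  shows "norm (complex_dist_sq a n x) \<le> 5 * dist x c"
proof -
  have c: "norm (c - a) = 1" "(c - a) \<bullet> n = 0"
    using assms(2) by (auto simp: unit_circle_def dist_norm norm_minus_commute)
  have "q \<bullet> q - p \<bullet> p = (q - p) \<bullet> (q + p)" for p q :: "real ^ 3"
    by (simp add: inner_diff_left inner_diff_right inner_add_right inner_commute)
  from this[of "x - a" "c - a"] have "(x - a) \<bullet> (x - a) - 1 = (x - c) \<bullet> ((x - a) + (c - a))"
    using c(1) by (simp add: norm_eq_1)
  moreover have "norm ((x - a) + (c - a)) \<le> 3"
  proof -
    have eq: "(x - a) + (c - a) = (x - c) + 2 *\<^sub>R (c - a)" by (simp add: algebra_simps scaleR_2)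
    show ?thesis unfolding eq
      by (rule order_trans[OF norm_triangle_ineq]) (use c(1) assms(3) in \<open>simp add: dist_norm\<close>)
  qed
  ultimately have "\<bar>(x - a) \<bullet> (x - a) - 1\<bar> \<le> norm (x - c) * 3"
    using Cauchy_Schwarz_ineq2[of "x - c" "(x - a) + (c - a)"]
      mult_left_mono[of "norm ((x - a) + (c - a))" 3 "norm (x - c)"] by simp
  moreover have "\<bar>(x - a) \<bullet> n\<bar> \<le> norm (x - c)"
  proof -
    have "(x - a) \<bullet> n = (x - c) \<bullet> n" using c(2) by (simp add: inner_diff_left)
    then show ?thesis using Cauchy_Schwarz_ineq2[of "x - c" n] assms(1) by simp
  qed
  ultimately show ?thesis using cmod_le[of "complex_dist_sq a n x"] by (simp add: complex_dist_sq_def dist_norm)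
qed

text \<open>Spheroidal coordinates inverted: \<open>r\<close> is the distance from the axis and
  \<open>s * t\<close> the height over the plane. Used to place a nonzero value of \<open>F\<close>
  in space.\<close>

lemma exists_spheroidal_point:
  assumes "norm n = 1" "0 < t" "t < 1"
  shows "\<exists>x. complex_dist_sq a n x = (Complex s t)\<^sup>2"
proof -
  obtain y where y: "y \<noteq> 0" "orthogonal n y"
    using orthogonal_to_vector_exists[of n] by auto
  define e where "e = (1 / norm y) *\<^sub>R y"
  have e: "e \<bullet> e = 1" "e \<bullet> n = 0" "n \<bullet> e = 0" using y
    by (auto simp: e_def orthogonal_def inner_commute dot_square_norm power2_eq_square)
  define r where "r = sqrt ((1 + s\<^sup>2) * (1 - t\<^sup>2))"
  have "t\<^sup>2 \<le> 1" using assms by (simp add: power_le_one)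
  then have r: "r * r = (1 + s\<^sup>2) * (1 - t\<^sup>2)" by (simp add: r_def)
  have n: "n \<bullet> n = 1" using assms(1) by (simp add: norm_eq_1)
  let ?q = "r *\<^sub>R e + (s * t) *\<^sub>R n"
  have "?q \<bullet> ?q = r * r + (s * t) * (s * t)" "?q \<bullet> n = s * t"
    using e n by (simp_all add: inner_add_left inner_add_right algebra_simps)
  then have "complex_dist_sq a n (a + ?q) = Complex (r * r + (s * t) * (s * t) - 1) (2 * (s * t))"
    by (simp add: complex_dist_sq_def)
  also have "\<dots> = (Complex s t)\<^sup>2"
    by (simp add: complex_eq_iff power2_eq_square r algebra_simps)
  finally have "complex_dist_sq a n (a + ?q) = (Complex s t)\<^sup>2" .
  then show ?thesis by blast
qed

theorem corollary6:
  fixes a n :: "real ^ 3" and C :: "(real ^ 3) set" and L :: "'e line_bundle" and k :: nat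
  assumes "norm n = 1" and "C = unit_circle a n"
    and "real_line_bundle (- C) L" and "twisted_around_circle a n L"
    and "k > 0"
  shows "\<exists>f. Z2_harmonic (- C) L f \<and>
           (\<exists>x\<in>- C. abs_sec L f x \<noteq> 0) \<and>
           (\<lambda>x. abs_sec L f x)
             \<in> O[filtercomap (\<lambda>x. infdist x C) (at_right 0)](\<lambda>x. infdist x C ^ k)"
proof -
  have "real_line_bundle (- unit_circle a n) L" using assms(2,3) by simp
  then interpret twisted_bundle a n L
    by (intro twisted_bundle.intro real_bundle.intro twisted_bundle_axioms.intro assms(1,4))
  \<comment> \<open>Near the circle |w|^2 is at most 5 times the distance, so order
    \<open>2 * k\<close> in w gives order \<open>k\<close> in the distance.\<close>
  obtain F F1 F2 F11 F12 F22 K s t where sol: "spheroidal_solution F F1 F2 F11 F12 F22"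
    and F0: "F1 0 = 0" "F2 0 = 0"
    and F_bound: "\<And>w. norm w \<le> 1 \<Longrightarrow> \<bar>F w\<bar> \<le> K * norm w ^ (2 * k)"
    and st: "0 < t" "t < 1" "F (Complex s t) \<noteq> 0"
    by (rule exists_spheroidal_solution[where M = "2 * k"]) (rule that)
  have odd: "F (- z) = - F z" for z using sol by (simp add: spheroidal_solution_def)
  obtain f where sec: "is_section (- C) L f"
    and rep: "\<forall>(U, \<phi>)\<in>trivs L. \<forall>x\<in>U. \<exists>N w. x \<in> N \<and> N \<subseteq> U \<and> root_branch a n N w \<and>
        (\<forall>y\<in>N. local_rep \<phi> f y = F (w y))"
    using exists_section[of F, OF odd] unfolding assms(2) by blast
  have pullback: "\<exists>N w. x \<in> N \<and> N \<subseteq> U \<and> spheroidal_pullback a n N w F F1 F2 F11 F12 F22 (local_rep \<phi> f)"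
    if U: "(U, \<phi>) \<in> trivs L" "x \<in> U" for U \<phi> x
  proof -
    have "\<forall>x\<in>U. \<exists>N w. x \<in> N \<and> N \<subseteq> U \<and> root_branch a n N w \<and> (\<forall>y\<in>N. local_rep \<phi> f y = F (w y))"
      using bspec[OF rep U(1)] by (simp only: prod.case)
    from bspec[OF this U(2)] obtain N w where N: "x \<in> N" "N \<subseteq> U" "root_branch a n N w"
      "\<And>y. y \<in> N \<Longrightarrow> local_rep \<phi> f y = F (w y)" by metis
    show ?thesis
      by (intro exI[of _ N] exI[of _ w] conjI N(1,2) spheroidal_pullback.intro norm_n N(3) sol N(4))
  qed
  have sec': "is_section (- unit_circle a n) L f" using sec assms(2) by simp
  have cont_grad: "\<exists>N. open N \<and> x \<in> N \<and> continuous_on N (norm_grad_sec L f)"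
    and root: "\<exists>w. w\<^sup>2 = complex_dist_sq a n x \<and> abs_sec L f x = \<bar>F w\<bar> \<and> norm_grad_sec L f x \<ge> 0 \<and>
       (\<forall>K. \<bar>F1 w\<bar> \<le> K * norm w \<longrightarrow> \<bar>F2 w\<bar> \<le> K * norm w \<longrightarrow>
          norm_grad_sec L f x \<le> 6 * K * (norm (x - a) + 1))"
    if "x \<in> - C" for x
  proof -
    have "x \<in> - unit_circle a n" using that assms(2) by simp
    then obtain U \<phi> where U: "(U, \<phi>) \<in> trivs L" "x \<in> U" by (rule triv_exists)
    obtain N w where N: "x \<in> N" "N \<subseteq> U" "spheroidal_pullback a n N w F F1 F2 F11 F12 F22 (local_rep \<phi> f)"
      using pullback[OF U] by blast
    interpret P: spheroidal_pullback a n N w F F1 F2 F11 F12 F22 "local_rep \<phi> f" by (rule N(3))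
    have grad: "norm_grad_sec L f y = norm (gradient (local_rep \<phi> f) y)" if "y \<in> N" for y
      using norm_grad_sec_eq[OF sec' U(1) _ P.differentiable_g] that N(2) by blast
    have "continuous_on N (norm_grad_sec L f)"
      by (rule continuous_on_eq[OF continuous_on_norm[OF P.continuous_on_gradient_g]]) (simp add: grad)
    then show "\<exists>N. open N \<and> x \<in> N \<and> continuous_on N (norm_grad_sec L f)"
      using P.open_N N(1) by (intro exI[of _ N]) simp
    show "\<exists>w. w\<^sup>2 = complex_dist_sq a n x \<and> abs_sec L f x = \<bar>F w\<bar> \<and> norm_grad_sec L f x \<ge> 0 \<and>
       (\<forall>K. \<bar>F1 w\<bar> \<le> K * norm w \<longrightarrow> \<bar>F2 w\<bar> \<le> K * norm w \<longrightarrow>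
          norm_grad_sec L f x \<le> 6 * K * (norm (x - a) + 1))"
      using abs_sec_eq[OF sec' U] P.g_eq[OF N(1)] P.w_props(2)[OF N(1)] P.norm_gradient_g_le[OF N(1)] grad[OF N(1)]
      by (intro exI[of _ "w x"]) simp
  qed
  have "harmonic_on U (local_rep \<phi> f)" if U: "(U, \<phi>) \<in> trivs L" for U \<phi>
  proof (rule harmonic_on_locally)
    fix x assume "x \<in> U"
    then obtain N w where N: "x \<in> N" "spheroidal_pullback a n N w F F1 F2 F11 F12 F22 (local_rep \<phi> f)"
      using pullback[OF U] by blast
    show "\<exists>N. open N \<and> x \<in> N \<and> harmonic_on N (local_rep \<phi> f)"
      using spheroidal_pullback.harmonic_on_g[OF N(2)] spheroidal_pullback.open_N[OF N(2)] N(1) by blast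
  qed
  moreover have "set_integrable lborel B (\<lambda>x. (norm_grad_sec L f x)\<^sup>2)"
    if B: "open B" "bounded B" "B \<subseteq> - C" for B
  proof -
    have cont: "continuous_on B (norm_grad_sec L f)"
    proof (rule continuous_at_imp_continuous_on, rule ballI)
      fix x assume "x \<in> B"
      then obtain N where "open N" "x \<in> N" "continuous_on N (norm_grad_sec L f)"
        using cont_grad[of x] B(3) by blast
      then show "isCont (norm_grad_sec L f) x" using continuous_on_eq_continuous_at by blast
    qed
    obtain R where R: "\<And>x. x \<in> B \<Longrightarrow> norm (x - a) \<le> R"
      using B(2) bounded_any_center[of B a] by (auto simp: dist_norm norm_minus_commute)
    \<comment> \<open>On \<open>B\<close> the root satisfies |w| \<le> |x - a| + 1 \<le> R +
      1.\<close>
    obtain K1 where K1: "\<And>w. norm w \<le> R + 1 \<Longrightarrow> \<bar>F1 w\<bar> \<le> K1 * norm w"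
      using continuous_derivative_linear_bound[of F1 F11 F12 "R + 1"] sol F0(1)
      unfolding spheroidal_solution_def by metis
    obtain K2 where K2: "\<And>w. norm w \<le> R + 1 \<Longrightarrow> \<bar>F2 w\<bar> \<le> K2 * norm w"
      using continuous_derivative_linear_bound[of F2 F12 F22 "R + 1"] sol F0(2)
      unfolding spheroidal_solution_def by metis
    define K where "K = \<bar>K1\<bar> + \<bar>K2\<bar>"
    have bound: "norm_grad_sec L f x \<le> 6 * K * (R + 1)" "norm_grad_sec L f x \<ge> 0" if x: "x \<in> B" for x
    proof -
      obtain w where w: "w\<^sup>2 = complex_dist_sq a n x"
         "\<And>K. \<bar>F1 w\<bar> \<le> K * norm w \<Longrightarrow> \<bar>F2 w\<bar> \<le> K * norm w \<Longrightarrow> norm_grad_sec L f x \<le> 6 * K * (norm (x - a) + 1)"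
         and nonneg: "norm_grad_sec L f x \<ge> 0"
        using root[of x] x B(3) by blast
      have "(norm w)\<^sup>2 \<le> (norm (x - a) + 1)\<^sup>2"
        using norm_complex_dist_sq_le[OF norm_n, of a x] by (simp add: norm_power flip: w(1))
      then have "norm w \<le> norm (x - a) + 1" by (rule power2_le_imp_le) simp
      then have wR: "norm w \<le> R + 1" using R[OF x] by simp
      have "K1 * norm w \<le> K * norm w" "K2 * norm w \<le> K * norm w"
        by (intro mult_right_mono; simp add: K_def)+
      then have "norm_grad_sec L f x \<le> 6 * K * (norm (x - a) + 1)"
        using K1[OF wR] K2[OF wR] by (intro w(2)) auto
      also have "\<dots> \<le> 6 * K * (R + 1)" using R[OF x] by (intro mult_left_mono) (auto simp: K_def)
      finally show "norm_grad_sec L f x \<le> 6 * K * (R + 1)" .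
      show "norm_grad_sec L f x \<ge> 0" by (rule nonneg)
    qed
    \<comment> \<open>The integrand is continuous and bounded on a bounded open set; no further
      estimate near the circle is involved.\<close>
    have "integrable lborel (\<lambda>x. indicator B x *\<^sub>R (norm_grad_sec L f x)\<^sup>2)"
    proof (rule integrableI_bounded_set[where A = B and B = "(6 * K * (R + 1))\<^sup>2"])
      show "(\<lambda>x. indicator B x *\<^sub>R (norm_grad_sec L f x)\<^sup>2) \<in> borel_measurable lborel"
        using borel_measurable_continuous_on_indicator[of B "\<lambda>x. (norm_grad_sec L f x)\<^sup>2"] B(1) cont
        by (simp add: continuous_on_power)
      show "emeasure lborel B < \<infinity>" using B(2) by (rule emeasure_bounded_finite)
      show "AE x\<in>B in lborel. norm (indicator B x *\<^sub>R (norm_grad_sec L f x)\<^sup>2) \<le> (6 * K * (R + 1))\<^sup>2"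
        using bound by (auto intro!: AE_I2 power_mono)
    qed (use B(1) in auto)
    then show ?thesis by (simp add: set_integrable_def)
  qed
  ultimately have "Z2_harmonic (- C) L f" using sec unfolding Z2_harmonic_def by blast
  moreover have "\<exists>x\<in>- C. abs_sec L f x \<noteq> 0"
  proof -
    obtain x where x: "complex_dist_sq a n x = (Complex s t)\<^sup>2" using exists_spheroidal_point[OF norm_n st(1,2)] by blast
    have "Complex s t \<noteq> 0" using st(1) by (simp add: complex_eq_iff)
    then have "complex_dist_sq a n x \<noteq> 0" by (simp add: x)
    then have xC: "x \<in> - C" using not_in_unit_circle assms(2) by blast
    obtain w where w: "w\<^sup>2 = complex_dist_sq a n x" "abs_sec L f x = \<bar>F w\<bar>" using root[OF xC] by blast
    \<comment> \<open>The root is known only up to sign, which is harmless as \<open>F\<close> is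
      odd.\<close>
    have "w = Complex s t \<or> w = - Complex s t" using w(1) x by (metis power2_eq_iff)
    then have "abs_sec L f x \<noteq> 0" using w(2) st(3) odd by auto
    then show ?thesis using xC by blast
  qed
  moreover have "(\<lambda>x. abs_sec L f x) \<in> O[filtercomap (\<lambda>x. infdist x C) (at_right 0)](\<lambda>x. infdist x C ^ k)"
  proof (rule bigoI)
    \<comment> \<open>Below 1/5 the root has norm at most 1, the range in which
      \<open>F_bound\<close> applies.\<close>
    have "\<forall>\<^sub>F d in at_right (0::real). 0 < d \<and> d < 1 / 5" by (rule eventually_at_rightI[of 0 "1 / 5"]) auto
    then show "\<forall>\<^sub>F x in filtercomap (\<lambda>x. infdist x C) (at_right 0).
        norm (abs_sec L f x) \<le> \<bar>K\<bar> * 5 ^ k * norm (infdist x C ^ k)"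
      unfolding eventually_filtercomap
    proof (intro exI conjI allI impI)
      fix x assume d: "0 < infdist x C \<and> infdist x C < 1 / 5"
      \<comment> \<open>\<open>infdist\<close> to the empty set is 0 by convention, so a positive
        value excludes that case.\<close>
      then have "C \<noteq> {}" by (auto simp: infdist_def)
      moreover have "closed C" using assms(2) closed_unit_circle by simp
      ultimately obtain c where c: "c \<in> C" "infdist x C = dist x c" using infdist_attains_inf by blast
      have xC: "x \<in> - C" using d by auto
      obtain w where w: "w\<^sup>2 = complex_dist_sq a n x" "abs_sec L f x = \<bar>F w\<bar>" using root[OF xC] by blast
      have "norm (complex_dist_sq a n x) \<le> 5 * dist x c"
        using norm_complex_dist_sq_le_dist[OF norm_n, of c a x] c d assms(2) by simp
      then have w5: "(norm w)\<^sup>2 \<le> 5 * infdist x C" by (simp add: c(2) norm_power flip: w(1))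
      then have "(norm w)\<^sup>2 \<le> 1\<^sup>2" using d by simp
      then have "norm w \<le> 1" by (rule power2_le_imp_le) simp
      then have "\<bar>F w\<bar> \<le> K * norm w ^ (2 * k)" by (rule F_bound)
      also have "\<dots> \<le> \<bar>K\<bar> * ((norm w)\<^sup>2) ^ k" by (simp add: power_mult mult_right_mono)
      also have "\<dots> \<le> \<bar>K\<bar> * (5 * infdist x C) ^ k" using w5 by (intro mult_left_mono power_mono) auto
      finally show "norm (abs_sec L f x) \<le> \<bar>K\<bar> * 5 ^ k * norm (infdist x C ^ k)"
        using d by (simp add: w(2) power_mult_distrib mult.assoc)
    qed
  qed
  ultimately show ?thesis by blast
qed

end
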